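(* Let $K$ be an algebraically closed field of characteristic zero, let $d\geq 5$ and $\ell\geq 2$ be integers with $d\equiv 0\pmod{\ell}$, and let $C\subset\mathbb{P}^2(K)$ be a non-singular plane curve of degree $d$. Assume that $Aut(C)$ contains an element of order $\ell(d-1)$. Then $C$ is isomorphic to a curve of the form $$X^d+Y^d+\alpha XZ^{d-1}+\sum_{2\leq j=\ell k\leq d-2}\beta_{j}X^{d-j}Y^j=0,$$ where $\alpha\in K$, $\alpha\neq 0$, the $\beta_j$ are in $K$, and the sum runs over the multiples $j=\ell k$ of $\ell$ with $2\le j\le d-2$. In particular, $Aut(C)$ is cyclic.
   Context: $Aut(C)$ is the full automorphism group of $C$ over $K$, identified with the finite subgroup of $PGL_3(K)$ preserving the defining equation of $C$. *)

theory Defs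
  imports
    "HOL-Analysis.Determinants"
    "HOL-Computational_Algebra.Polynomial"
    "HOL-Library.Poly_Mapping"
    "HOL-Algebra.Elementary_Groups"
    "HOL-Algebra.Multiplicative_Group"
begin

text \<open>
  The variables are indexed by the three-element type \<^typ>\<open>3\<close>, whose elements are \<open>1\<close>, \<open>2\<close>
  and \<open>3 = 0\<close>. A monomial is an exponent vector \<^typ>\<open>3 \<Rightarrow>\<^sub>0 nat\<close>, and the ring structure on
  polynomials is the monoid-algebra structure of \<^theory>\<open>HOL-Library.Poly_Mapping\<close>.
\<close>

type_synonym 'a poly3 = "(3 \<Rightarrow>\<^sub>0 nat) \<Rightarrow>\<^sub>0 'a"

definition Const :: "'a::zero \<Rightarrow> 'a poly3" where
  "Const c = Poly_Mapping.single 0 c"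

definition Var :: "3 \<Rightarrow> 'a::zero_neq_one poly3" where
  "Var i = Poly_Mapping.single (Poly_Mapping.single i 1) 1"

abbreviation X :: "'a::zero_neq_one poly3" where "X \<equiv> Var 1"
abbreviation Y :: "'a::zero_neq_one poly3" where "Y \<equiv> Var 2"
abbreviation Z :: "'a::zero_neq_one poly3" where "Z \<equiv> Var 3"

definition homogeneous :: "nat \<Rightarrow> 'a::zero poly3 \<Rightarrow> bool" where
  "homogeneous d F \<longleftrightarrow>
     (\<forall>m \<in> Poly_Mapping.keys F. (\<Sum>i\<in>UNIV. Poly_Mapping.lookup m i) = d)"

definition eval :: "'a::comm_semiring_1 poly3 \<Rightarrow> 'a ^ 3 \<Rightarrow> 'a" where
  "eval F v = (\<Sum>m \<in> Poly_Mapping.keys F.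
     Poly_Mapping.lookup F m * (\<Prod>i\<in>UNIV. (v $ i) ^ Poly_Mapping.lookup m i))"

definition partial_deriv :: "3 \<Rightarrow> 'a::comm_semiring_1 poly3 \<Rightarrow> 'a poly3" where
  "partial_deriv i F = (\<Sum>m \<in> Poly_Mapping.keys F.
     Poly_Mapping.single (m - Poly_Mapping.single i 1)
       (of_nat (Poly_Mapping.lookup m i) * Poly_Mapping.lookup F m))"

text \<open>
  \<open>lin_subst A F\<close> is the polynomial \<open>F \<circ> A\<close>: the \<open>i\<close>-th variable is replaced by the \<open>i\<close>-th
  coordinate of \<open>A (X, Y, Z)\<^sup>T\<close>.
\<close>

definition lin_subst :: "'a::comm_semiring_1 ^ 3 ^ 3 \<Rightarrow> 'a poly3 \<Rightarrow> 'a poly3" where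
  "lin_subst A F = (\<Sum>m \<in> Poly_Mapping.keys F.
     Const (Poly_Mapping.lookup F m) *
     (\<Prod>i\<in>UNIV. (\<Sum>j\<in>UNIV. Const (A $ i $ j) * Var j) ^ Poly_Mapping.lookup m i))"

text \<open>
  A plane curve is represented by its defining form. A point of the projective plane is
  represented by its nonzero coordinate vectors.
\<close>

definition plane_curve :: "nat \<Rightarrow> 'a::zero poly3 \<Rightarrow> bool" where
  "plane_curve d F \<longleftrightarrow> F \<noteq> 0 \<and> homogeneous d F"

definition nonsingular :: "'a::comm_semiring_1 poly3 \<Rightarrow> bool" where
  "nonsingular F \<longleftrightarrow>
     \<not> (\<exists>v. v \<noteq> 0 \<and> eval F v = 0 \<and> (\<forall>i. eval (partial_deriv i F) v = 0))"

text \<open>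
  The linear map \<open>A\<close> carries the curve \<open>G = 0\<close> onto the curve \<open>F = 0\<close>: the forms \<open>F \<circ> A\<close> and
  \<open>G\<close> agree up to a nonzero factor.
\<close>

definition carries :: "'a::comm_semiring_1 ^ 3 ^ 3 \<Rightarrow> 'a poly3 \<Rightarrow> 'a poly3 \<Rightarrow> bool" where
  "carries A G F \<longleftrightarrow> (\<exists>c. c \<noteq> 0 \<and> lin_subst A F = Const c * G)"

text \<open>
  Isomorphisms of plane curves, like the automorphisms below, are those induced by projective
  linear transformations of the ambient plane. For non-singular curves of degree at least \<open>4\<close>
  these are all the isomorphisms.
\<close>

definition isomorphic_curves :: "'a::comm_semiring_1 poly3 \<Rightarrow> 'a poly3 \<Rightarrow> bool" where
  "isomorphic_curves F G \<longleftrightarrow> (\<exists>A. invertible A \<and> carries A F G)"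

definition GL3 :: "('a::semiring_1 ^ 3 ^ 3) monoid" where
  "GL3 = \<lparr>carrier = {A. invertible A}, monoid.mult = (**), one = mat 1\<rparr>"

definition scalars3 :: "('a::semiring_1 ^ 3 ^ 3) set" where
  "scalars3 = {mat c | c. c \<noteq> 0}"

definition PGL3 :: "('a::semiring_1 ^ 3 ^ 3) set monoid" where
  "PGL3 = GL3 Mod scalars3"

definition Aut :: "'a::comm_semiring_1 poly3 \<Rightarrow> ('a ^ 3 ^ 3) set monoid" where
  "Aut F = PGL3\<lparr>carrier := {scalars3 #>\<^bsub>GL3\<^esub> A | A. A \<in> carrier GL3 \<and> carries A F F}\<rparr>"

end

theory Submission
  imports Defs
begin

text \<open>
  A representative of the given element can be diagonalised. By nonsingularity the form contains,
  for every \<open>i\<close>, a monomial \<open>x\<^sub>i^(d-1) x\<^sub>j\<close> with \<open>j = j(i)\<close>; comparing eigenvalues, the order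
  \<open>l (d - 1)\<close> forces the image of \<open>j\<close> to have two elements. After a permutation and a scaling of
  the coordinates the element is either \<open>diag(1, x, y)\<close> with \<open>x\<close>, \<open>y\<close> of orders \<open>l\<close>, \<open>d - 1\<close>,
  and then only the monomials of the normal form are invariant, or \<open>x = -1\<close>, \<open>y^(d-1) = -1\<close>, and
  then the form is divisible by the first variable, hence singular.

  For the normal form, let \<open>T\<close> be an automorphism and \<open>e = (0, 0, 1)\<close>. If \<open>T e\<close> were not
  proportional to \<open>e\<close>, then the restriction of the form to the line through \<open>e\<close> and \<open>T\<^sup>-\<^sup>1 e\<close>,
  computed directly and through \<open>T\<close>, would give an identity
  \<open>a (p + w)^n + h = b w (1 + r w)^n + h' w^(n+1)\<close> with \<open>n = d - 1\<close> and \<open>a, b \<noteq> 0\<close>, which the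
  coefficients of \<open>w\<close>, \<open>w\<^sup>2\<close>, \<open>w\<^sup>3\<close> exclude for \<open>n > 3\<close>. So \<open>T\<close> fixes the point \<open>e\<close>;
  then it is diagonal, \<open>diag(1, u, v)\<close> with \<open>u^d = v^(d-1) = 1\<close> up to a scalar, and \<open>u v\<close>
  determines \<open>u\<close> and \<open>v\<close>. Thus the automorphism group embeds in the multiplicative group of the field.
\<close>

section \<open>Evaluation of ternary forms\<close>

lemma prod_UNIV_3: "prod f (UNIV::3 set) = f 1 * f 2 * f 3"
  unfolding UNIV_3 by (simp add: ac_simps)

section \<open>Monomials and the evaluation homomorphism\<close>

definition mon_eval :: "(3 \<Rightarrow>\<^sub>0 nat) \<Rightarrow> 'a::comm_semiring_1 ^ 3 \<Rightarrow> 'a" where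
  "mon_eval m v = (\<Prod>i\<in>UNIV. (v $ i) ^ Poly_Mapping.lookup m i)"

lemma mon_eval_0 [simp]: "mon_eval 0 v = 1"
  by (simp add: mon_eval_def)

lemma mon_eval_add: "mon_eval (m + n) v = mon_eval m v * mon_eval n v"
  by (simp add: mon_eval_def lookup_add power_add prod.distrib)

lemma mon_eval_single: "mon_eval (Poly_Mapping.single i k) v = (v $ i) ^ k"
proof -
  have "mon_eval (Poly_Mapping.single i k) v = (\<Prod>j\<in>UNIV. if j = i then (v $ i) ^ k else 1)"
    unfolding mon_eval_def by (intro prod.cong) (auto simp: lookup_single)
  then show ?thesis by simp
qed

lemma eval_superset:
  assumes "finite S" "Poly_Mapping.keys F \<subseteq> S"
  shows "eval F v = (\<Sum>m\<in>S. Poly_Mapping.lookup F m * mon_eval m v)"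
  unfolding eval_def mon_eval_def[symmetric]
  by (rule sum.mono_neutral_left) (use assms in \<open>auto simp: in_keys_iff\<close>)

lemma eval_0 [simp]: "eval 0 v = 0"
  by (simp add: eval_def)

lemma eval_add: "eval (F + G) v = eval F v + eval G v"
proof -
  let ?S = "Poly_Mapping.keys F \<union> Poly_Mapping.keys G"
  have "Poly_Mapping.keys (F + G) \<subseteq> ?S" by (rule Poly_Mapping.keys_add)
  then show ?thesis
    by (simp add: eval_superset[of ?S] lookup_add algebra_simps sum.distrib)
qed

lemma eval_sum: "eval (sum F S) v = (\<Sum>x\<in>S. eval (F x) v)"
  by (induction S rule: infinite_finite_induct) (auto simp: eval_add)

lemma eval_single: "eval (Poly_Mapping.single m c) v = c * mon_eval m v"
  by (subst eval_superset[of "{m}"]) auto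

lemma poly_mapping_eq_sum_single:
  "F = (\<Sum>m\<in>Poly_Mapping.keys F. Poly_Mapping.single m (Poly_Mapping.lookup F m))"
proof (rule poly_mapping_eqI)
  fix k
  show "Poly_Mapping.lookup F k =
      Poly_Mapping.lookup (\<Sum>m\<in>Poly_Mapping.keys F. Poly_Mapping.single m (Poly_Mapping.lookup F m)) k"
    by (cases "k \<in> Poly_Mapping.keys F") (auto simp: lookup_sum lookup_single when_def in_keys_iff)
qed

lemma eval_mult: "eval (F * G) v = eval F v * eval G v"
proof -
  let ?s = "\<lambda>F m. Poly_Mapping.single m (Poly_Mapping.lookup F m)"
  have "F * G = (\<Sum>m\<in>Poly_Mapping.keys F. ?s F m) * (\<Sum>m\<in>Poly_Mapping.keys G. ?s G m)"
    by (simp flip: poly_mapping_eq_sum_single)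
  also have "\<dots> = (\<Sum>m\<in>Poly_Mapping.keys F. \<Sum>n\<in>Poly_Mapping.keys G.
      Poly_Mapping.single (m + n) (Poly_Mapping.lookup F m * Poly_Mapping.lookup G n))"
    by (simp add: sum_product mult_single)
  finally have FG: "F * G = \<dots>" .
  show ?thesis
    unfolding FG eval_sum eval_single mon_eval_add
    by (simp add: eval_def sum_product ac_simps flip: mon_eval_def)
qed

lemma eval_Const [simp]: "eval (Const c) v = c"
  by (simp add: Const_def eval_single)

lemma eval_Var [simp]: "eval (Var i) v = v $ i"
  by (simp add: Var_def eval_single mon_eval_single)

lemma eval_1 [simp]: "eval 1 v = 1"
  by (metis eval_Const Const_def single_one)

lemma eval_power: "eval (F ^ n) v = eval F v ^ n"
  by (induction n) (auto simp: eval_mult)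

lemma eval_prod: "eval (prod F S) v = (\<Prod>x\<in>S. eval (F x) v)"
  by (induction S rule: infinite_finite_induct) (auto simp: eval_mult)

lemma eval_lin_subst: "eval (lin_subst A F) v = eval F (A *v v)"
  unfolding lin_subst_def eval_def[of F]
  by (simp add: eval_sum eval_mult eval_prod eval_power matrix_vector_mult_def)

lemma eval_partial_deriv:
  "eval (partial_deriv i F) v = (\<Sum>m\<in>Poly_Mapping.keys F.
     of_nat (Poly_Mapping.lookup m i) * Poly_Mapping.lookup F m *
       mon_eval (m - Poly_Mapping.single i 1) v)"
  by (simp add: partial_deriv_def eval_sum eval_single)

text \<open>A polynomial over a field of characteristic zero that vanishes everywhere has zero
  coefficients. Several indices may share an exponent, so only the sum over a fibre of
  \<open>f\<close> is known to vanish.\<close>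

lemma sum_power_eq_0_imp:
  fixes c :: "'b \<Rightarrow> 'a::field_char_0" and f :: "'b \<Rightarrow> nat"
  assumes "finite S" "\<And>x. (\<Sum>m\<in>S. c m * x ^ f m) = 0"
  shows "(\<Sum>m | m \<in> S \<and> f m = k. c m) = 0"
proof -
  let ?p = "\<Sum>m\<in>S. Polynomial.monom (c m) (f m)"
  have "poly ?p x = 0" for x
    using assms(2)[of x] by (simp add: poly_sum poly_monom)
  then have "?p = 0" using poly_all_0_iff_0 by blast
  then have "Polynomial.coeff ?p k = 0" by simp
  then show ?thesis
    using assms(1) by (simp add: coeff_sum sum.If_cases Int_def)
qed

lemma mon_eval_vector_3:
  "mon_eval m (vector [x, y, z]) =
     x ^ Poly_Mapping.lookup m 1 * y ^ Poly_Mapping.lookup m 2 * z ^ Poly_Mapping.lookup m 3"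
  by (simp add: mon_eval_def prod_UNIV_3)

lemma poly_mapping3_eqI:
  fixes m n :: "3 \<Rightarrow>\<^sub>0 'b::zero"
  assumes "Poly_Mapping.lookup m 1 = Poly_Mapping.lookup n 1"
    "Poly_Mapping.lookup m 2 = Poly_Mapping.lookup n 2"
    "Poly_Mapping.lookup m 3 = Poly_Mapping.lookup n 3"
  shows "m = n"
  by (rule poly_mapping_eqI) (metis assms exhaust_3)

text \<open>Distinct monomials are linearly independent as functions. The three variables are
  separated one after another, and fixing all three exponents leaves the single index
  \<open>n\<close>.\<close>

lemma sum_mon_eval_eq_0_imp:
  fixes c :: "(3 \<Rightarrow>\<^sub>0 nat) \<Rightarrow> 'a::field_char_0"
  assumes S: "finite S" and zero: "\<And>v. (\<Sum>m\<in>S. c m * mon_eval m v) = 0" and "n \<in> S"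
  shows "c n = 0"
proof -
  let ?l = Poly_Mapping.lookup
  have 1: "(\<Sum>m\<in>S. c m * x ^ ?l m 1 * y ^ ?l m 2 * z ^ ?l m 3) = 0" for x y z
    using zero[of "vector [x, y, z]"] by (simp add: mon_eval_vector_3 mult.assoc)
  let ?S1 = "{m. m \<in> S \<and> ?l m 3 = ?l n 3}"
  have 2: "(\<Sum>m\<in>?S1. c m * x ^ ?l m 1 * y ^ ?l m 2) = 0" for x y
    by (rule sum_power_eq_0_imp) (use S 1 in auto)
  let ?S2 = "{m. m \<in> ?S1 \<and> ?l m 2 = ?l n 2}"
  have 3: "(\<Sum>m\<in>?S2. c m * x ^ ?l m 1) = 0" for x
    by (rule sum_power_eq_0_imp) (use S 2 in auto)
  have 4: "(\<Sum>m | m \<in> ?S2 \<and> ?l m 1 = ?l n 1. c m) = 0"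
    by (rule sum_power_eq_0_imp) (use S 3 in auto)
  have "{m. m \<in> ?S2 \<and> ?l m 1 = ?l n 1} = {n}"
    using \<open>n \<in> S\<close> by (auto intro: poly_mapping3_eqI)
  with 4 show ?thesis by simp
qed

text \<open>Identities of polynomials can from here on be checked on values, where substitution is
  composition with a linear map.\<close>

lemma poly3_eqI:
  fixes F G :: "'a::field_char_0 poly3"
  assumes "\<And>v. eval F v = eval G v"
  shows "F = G"
proof (rule poly_mapping_eqI)
  fix n
  let ?S = "Poly_Mapping.keys F \<union> Poly_Mapping.keys G"
  let ?c = "\<lambda>m. Poly_Mapping.lookup F m - Poly_Mapping.lookup G m"
  have "(\<Sum>m\<in>?S. ?c m * mon_eval m v) = 0" for v
    using assms[of v] eval_superset[of ?S F v] eval_superset[of ?S G v]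
    by (simp add: algebra_simps sum_subtractf)
  then have "n \<in> ?S \<Longrightarrow> ?c n = 0"
    by (intro sum_mon_eval_eq_0_imp[of ?S ?c]) auto
  then show "Poly_Mapping.lookup F n = Poly_Mapping.lookup G n"
    by (cases "n \<in> ?S") (auto simp: in_keys_iff)
qed

lemma carries_iff:
  fixes F G :: "'a::field_char_0 poly3"
  shows "carries A G F \<longleftrightarrow> (\<exists>c. c \<noteq> 0 \<and> (\<forall>v. eval F (A *v v) = c * eval G v))"
proof -
  have "lin_subst A F = Const c * G \<longleftrightarrow> (\<forall>v. eval F (A *v v) = c * eval G v)" for c
  proof
    assume "\<forall>v. eval F (A *v v) = c * eval G v"
    then show "lin_subst A F = Const c * G"
      by (intro poly3_eqI) (simp add: eval_lin_subst eval_mult)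
  next
    assume "lin_subst A F = Const c * G"
    then show "\<forall>v. eval F (A *v v) = c * eval G v"
      by (metis eval_lin_subst eval_mult eval_Const)
  qed
  then show ?thesis by (auto simp: carries_def)
qed

section \<open>Homogeneity read off from values\<close>

definition mon_degree :: "(3 \<Rightarrow>\<^sub>0 nat) \<Rightarrow> nat" where
  "mon_degree m = (\<Sum>i\<in>UNIV. Poly_Mapping.lookup m i)"

lemma mon_eval_scale: "mon_eval m (t *s v) = t ^ mon_degree m * mon_eval m v"
  by (simp add: mon_eval_def mon_degree_def power_mult_distrib prod.distrib power_sum)

text \<open>The scaling law, unlike the condition on exponents, passes at once to linear
  substitutions. For the converse, comparing powers of \<open>t\<close> isolates the part of each
  degree, and independence of the monomials excludes degrees other than \<open>d\<close>.\<close>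

lemma homogeneous_iff:
  fixes F :: "'a::field_char_0 poly3"
  shows "homogeneous d F \<longleftrightarrow> (\<forall>t v. eval F (t *s v) = t ^ d * eval F v)"
proof
  assume "homogeneous d F"
  then show "\<forall>t v. eval F (t *s v) = t ^ d * eval F v"
    unfolding eval_def homogeneous_def mon_degree_def[symmetric] mon_eval_def[symmetric]
    by (simp add: mon_eval_scale sum_distrib_left ac_simps)
next
  assume hom: "\<forall>t v. eval F (t *s v) = t ^ d * eval F v"
  let ?K = "Poly_Mapping.keys F"
  show "homogeneous d F"
    unfolding homogeneous_def mon_degree_def[symmetric]
  proof (rule ballI, rule ccontr)
    fix n assume n: "n \<in> ?K" "mon_degree n \<noteq> d"
    let ?S = "{m. m \<in> ?K \<and> mon_degree m = mon_degree n}"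
    have "(\<Sum>m\<in>?S. Poly_Mapping.lookup F m * mon_eval m v) = 0" for v
    proof -
      let ?p = "(\<Sum>m\<in>?K. Polynomial.monom (Poly_Mapping.lookup F m * mon_eval m v) (mon_degree m)) 
                - Polynomial.monom (eval F v) d"
      have "poly ?p t = 0" for t
        using hom[rule_format, of t v]
        by (simp add: eval_superset[of ?K] poly_sum poly_monom mon_eval_scale ac_simps)
      then have "?p = 0" using poly_all_0_iff_0 by blast
      then have "Polynomial.coeff ?p (mon_degree n) = 0" by simp
      then show ?thesis using n by (simp add: coeff_sum sum.If_cases Int_def)
    qed
    moreover have "finite ?S" "n \<in> ?S" using n by simp_all
    ultimately have "Poly_Mapping.lookup F n = 0"
      using sum_mon_eval_eq_0_imp[of ?S "Poly_Mapping.lookup F" n] by blast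
    with n show False by (simp add: in_keys_iff)
  qed
qed

section \<open>Nonsingular forms\<close>

text \<open>The restriction of \<open>F\<close> to the line through \<open>v\<close> in direction
  \<open>w\<close>. Its two lowest coefficients are the value at \<open>v\<close> and the derivative
  in direction \<open>w\<close>.\<close>

definition line_poly :: "'a::field_char_0 poly3 \<Rightarrow> 'a ^ 3 \<Rightarrow> 'a ^ 3 \<Rightarrow> 'a poly" where
  "line_poly F v w = (\<Sum>m\<in>Poly_Mapping.keys F.
     Polynomial.smult (Poly_Mapping.lookup F m) (\<Prod>i\<in>UNIV. [:v $ i, w $ i:] ^ Poly_Mapping.lookup m i))"

lemma poly_line_poly: "poly (line_poly F v w) t = eval F (v + t *s w)"
  by (simp add: line_poly_def eval_def poly_sum poly_prod mult.commute)

lemma coeff_0_line_poly: "Polynomial.coeff (line_poly F v w) 0 = eval F v"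
  using poly_line_poly[of F v w 0] by (simp add: poly_0_coeff_0)

lemma coeff_1_line_poly:
  "Polynomial.coeff (line_poly F v w) 1 = (\<Sum>i\<in>UNIV. w $ i * eval (partial_deriv i F) v)"
proof -
  have ne: "(1::3) \<noteq> 2" "(1::3) \<noteq> 3" "(2::3) \<noteq> 3" by simp_all
  have lk: "Poly_Mapping.lookup (m - Poly_Mapping.single i 1) j =
      Poly_Mapping.lookup m j - (if i = j then 1 else 0)" for m :: "3 \<Rightarrow>\<^sub>0 nat" and i j
    by (simp add: lookup_minus lookup_single when_def)
  have mon: "poly (pderiv (\<Prod>i\<in>UNIV. [:v $ i, w $ i:] ^ Poly_Mapping.lookup m i)) 0 =
      (\<Sum>i\<in>UNIV. w $ i * (of_nat (Poly_Mapping.lookup m i) *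
        mon_eval (m - Poly_Mapping.single i 1) v))" for m
    unfolding prod_UNIV_3 sum_3 mon_eval_def lk
    using ne ne[symmetric]
    by (simp add: pderiv_mult pderiv_power pderiv_pCons poly_power algebra_simps del: One_nat_def)
  have "Polynomial.coeff (line_poly F v w) 1 = poly (pderiv (line_poly F v w)) 0"
    by (simp add: poly_0_coeff_0 coeff_pderiv)
  also have "\<dots> = (\<Sum>m\<in>Poly_Mapping.keys F. Poly_Mapping.lookup F m *
      (\<Sum>i\<in>UNIV. w $ i * (of_nat (Poly_Mapping.lookup m i) *
        mon_eval (m - Poly_Mapping.single i 1) v)))"
    unfolding line_poly_def
    by (subst higher_pderiv_sum[of 1, simplified]) (simp add: pderiv_smult poly_sum mon)
  also have "\<dots> = (\<Sum>i\<in>UNIV. w $ i * eval (partial_deriv i F) v)"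
    unfolding sum_distrib_left eval_partial_deriv
    by (subst sum.swap) (simp add: ac_simps)
  finally show ?thesis .
qed

text \<open>This description of singular points is visibly compatible with linear substitutions.\<close>

lemma nonsingular_iff:
  fixes F :: "'a::field_char_0 poly3"
  shows "nonsingular F \<longleftrightarrow>
    \<not> (\<exists>v. v \<noteq> 0 \<and> (\<forall>w. Polynomial.coeff (line_poly F v w) 0 = 0 \<and>
                         Polynomial.coeff (line_poly F v w) 1 = 0))"
proof -
  have "(\<forall>w. (\<Sum>i\<in>UNIV. w $ i * eval (partial_deriv i F) v) = 0) \<longleftrightarrow>
      (\<forall>i. eval (partial_deriv i F) v = 0)" for v
  proof safe
    fix i assume *: "\<forall>w. (\<Sum>i\<in>UNIV. w $ i * eval (partial_deriv i F) v) = 0"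
    have "(\<Sum>j\<in>UNIV. axis i 1 $ j * eval (partial_deriv j F) v) = 
      (\<Sum>j\<in>UNIV. if j = i then eval (partial_deriv j F) v else 0)"
      by (intro sum.cong) (auto simp: axis_def)
    with *[rule_format, of "axis i 1"] show "eval (partial_deriv i F) v = 0"
      by simp
  qed simp
  then show ?thesis
    by (auto simp: nonsingular_def coeff_0_line_poly coeff_1_line_poly simp del: One_nat_def)
qed

lemma line_poly_lin_subst: "line_poly (lin_subst P F) v w = line_poly F (P *v v) (P *v w)"
proof -
  have "poly (line_poly (lin_subst P F) v w) = poly (line_poly F (P *v v) (P *v w))"
    by (rule ext) (simp add: poly_line_poly eval_lin_subst matrix_vector_right_distrib
        vector_scalar_commute)
  then show ?thesis by (simp add: poly_eq_poly_eq_iff)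
qed

text \<open>A singular point \<open>v\<close> of the substituted form would give the singular point
  \<open>P *v v\<close> of \<open>F\<close>: every direction there is the image of some direction at
  \<open>v\<close>.\<close>

lemma nonsingular_lin_subst:
  fixes F :: "'a::field_char_0 poly3"
  assumes "invertible P" "nonsingular F"
  shows "nonsingular (lin_subst P F)"
proof -
  obtain Q where Q: "P ** Q = mat 1" "Q ** P = mat 1"
    using assms(1) by (auto simp: invertible_def)
  have PQ: "P *v (Q *v w) = w" "Q *v (P *v w) = w" for w
    by (simp_all add: matrix_vector_mul_assoc Q)
  show ?thesis
    unfolding nonsingular_iff line_poly_lin_subst
  proof safe
    fix v assume v: "v \<noteq> 0" "\<forall>w. Polynomial.coeff (line_poly F (P *v v) (P *v w)) 0 = 0 \<and>
        Polynomial.coeff (line_poly F (P *v v) (P *v w)) 1 = 0"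
    have "P *v v \<noteq> 0" using v(1) PQ(2)[of v] by force
    moreover have "Polynomial.coeff (line_poly F (P *v v) w) 0 = 0 \<and>
        Polynomial.coeff (line_poly F (P *v v) w) 1 = 0" for w
      using v(2)[rule_format, of "Q *v w"] by (simp add: PQ)
    ultimately show False
      using assms(2) unfolding nonsingular_iff by blast
  qed
qed

lemma homogeneous_lin_subst:
  fixes F :: "'a::field_char_0 poly3"
  assumes "homogeneous d F"
  shows "homogeneous d (lin_subst P F)"
  using assms by (simp add: homogeneous_iff eval_lin_subst vector_scalar_commute)

lemma mon_eval_axis:
  "mon_eval m (axis i (1::'a::field_char_0)) \<noteq> 0 \<longleftrightarrow>
    (\<forall>k. k \<noteq> i \<longrightarrow> Poly_Mapping.lookup m k = 0)"
  by (auto simp: mon_eval_def axis_def)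

text \<open>At the \<open>i\<close>-th coordinate point only the \<open>d\<close>-th power of the
  \<open>i\<close>-th variable contributes to the value, and only the monomial with exponent
  \<open>d - 1\<close> at \<open>i\<close> and one further factor \<open>j\<close> to the
  \<open>j\<close>-th derivative. If none of these occurs, the point is singular.\<close>

lemma nonsingular_imp_monomial:
  fixes F :: "'a::field_char_0 poly3"
  assumes "nonsingular F" "homogeneous d F" "d > 0"
  shows "\<exists>j. Poly_Mapping.single i (d - 1) + Poly_Mapping.single j 1 \<in> Poly_Mapping.keys F"
proof (rule ccontr)
  assume none: "\<not> ?thesis"
  \<comment> \<open>Used twice: with \<open>j = i\<close> for the value, and with arbitrary
    \<open>j\<close> for the partial derivatives.\<close>
  have key: False if m: "m \<in> Poly_Mapping.keys F"
    and supp: "\<forall>k. k \<noteq> i \<longrightarrow> Poly_Mapping.lookup (m - Poly_Mapping.single j 1) k = 0"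
    and j: "Poly_Mapping.lookup m j \<noteq> 0" for m j
  proof -
    let ?k = "Poly_Mapping.lookup (m - Poly_Mapping.single j 1) i"
    have "m - Poly_Mapping.single j 1 = Poly_Mapping.single i ?k"
      by (rule poly_mapping_eqI) (use supp in \<open>auto simp: lookup_single when_def\<close>)
    moreover have "m - Poly_Mapping.single j 1 + Poly_Mapping.single j 1 = m"
      by (rule poly_mapping_eqI) (use j in \<open>auto simp: lookup_add lookup_minus lookup_single when_def\<close>)
    ultimately have m_eq: "m = Poly_Mapping.single i ?k + Poly_Mapping.single j 1"
      by metis
    have "mon_degree m = d"
      using assms(2) m by (simp add: homogeneous_def mon_degree_def)
    moreover have "mon_degree (Poly_Mapping.single a b) = b" for a b
      by (simp add: mon_degree_def lookup_single when_def)
    ultimately have "?k = d - 1"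
      by (subst (asm) m_eq) (simp add: mon_degree_def lookup_add sum.distrib)
    with m_eq none m show False by metis
  qed
  have "eval F (axis i 1) = 0"
    unfolding eval_def mon_eval_def[symmetric]
  proof (rule sum.neutral, rule ballI, rule ccontr)
    fix m assume m: "m \<in> Poly_Mapping.keys F"
      "Poly_Mapping.lookup F m * mon_eval m (axis i 1) \<noteq> 0"
    then have s: "\<forall>k. k \<noteq> i \<longrightarrow> Poly_Mapping.lookup m k = 0"
      by (simp add: mon_eval_axis)
    have "(\<Sum>k\<in>UNIV. Poly_Mapping.lookup m k) = d"
      using assms(2) m by (simp add: homogeneous_def)
    with s \<open>d > 0\<close> have "Poly_Mapping.lookup m i \<noteq> 0"
      by (metis neq0_conv sum.neutral)
    with key[OF m(1), of i] s show False by (simp add: lookup_minus)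
  qed
  moreover have "eval (partial_deriv j F) (axis i 1) = 0" for j
    unfolding eval_partial_deriv
  proof (rule sum.neutral, rule ballI, rule ccontr)
    fix m assume m: "m \<in> Poly_Mapping.keys F"
      "of_nat (Poly_Mapping.lookup m j) * Poly_Mapping.lookup F m *
        mon_eval (m - Poly_Mapping.single j 1) (axis i 1) \<noteq> 0"
    then have "Poly_Mapping.lookup m j \<noteq> 0" "mon_eval (m - Poly_Mapping.single j 1) (axis i (1::'a)) \<noteq> 0"
      by auto
    with key[OF m(1), of j] show False unfolding mon_eval_axis by blast
  qed
  moreover have "axis i (1::'a) \<noteq> 0" by (simp add: axis_eq_0_iff)
  ultimately show False using assms(1) by (auto simp: nonsingular_def)
qed

section \<open>Forms with a diagonal automorphism\<close>

lemma three_distinct: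
  fixes p q r :: 3
  assumes "p \<noteq> q" "p \<noteq> r" "q \<noteq> r"
  shows "k = p \<or> k = q \<or> k = r"
  using assms exhaust_3[of p] exhaust_3[of q] exhaust_3[of r] exhaust_3[of k] by fastforce

text \<open>Here \<open>j\<close> and \<open>c\<close> come from the monomials \<open>x\<^sub>i^(d-1) x\<^sub>j\<close> of a form that is scaled by \<open>c\<close>
  under the diagonal matrix with entries \<open>a\<close>.\<close>

lemma exists_eigenvalue_pattern:
  fixes a :: "3 \<Rightarrow> 'a::field_char_0" and j :: "3 \<Rightarrow> 3"
  assumes "d \<ge> 3" "l \<ge> 2" "l dvd d"
    and nz: "\<And>i. a i \<noteq> 0"
    and eq: "\<And>i. a i ^ (d - 1) * a (j i) = c"
    and ord: "\<And>n. (\<exists>t. \<forall>i. a i ^ n = t) \<Longrightarrow> l * (d - 1) dvd n"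
    and per: "\<And>i k. a i ^ (l * (d - 1)) = a k ^ (l * (d - 1))"
  obtains p q r where "p \<noteq> q" "p \<noteq> r" "q \<noteq> r" "a q ^ l = a p ^ l" "a r ^ (d - 1) * a p = c"
    "c = a p ^ d \<or> (a q = - a p \<and> c = - (a p ^ d))"
proof -
  have d0: "a i ^ d = a i ^ (d - 1) * a i" for i
    using assms(1) by (metis Suc_diff_1 less_le_trans power_Suc2 zero_less_numeral)
  \<comment> \<open>The \<open>l\<close>-th power of \<open>eq\<close> contains the factor
    \<open>a i ^ (l * (d - 1))\<close>, which \<open>per\<close> makes independent of
    \<open>i\<close>, so it cancels.\<close>
  have jl: "a (j i) ^ l = a (j k) ^ l" for i k
  proof -
    have "a i ^ (l * (d - 1)) * a (j i) ^ l = a k ^ (l * (d - 1)) * a (j k) ^ l"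
      using eq[of i] eq[of k] by (metis mult.commute power_mult power_mult_distrib)
    with per[of i k] nz show ?thesis by simp
  qed
  \<comment> \<open>Otherwise all \<open>l\<close>-th powers of the eigenvalues agree, and the
    projective order divides \<open>l\<close>.\<close>
  have "\<not> surj j"
  proof
    assume "surj j"
    then have "a i ^ l = a k ^ l" for i k using jl by (metis surjD)
    then have "l * (d - 1) dvd l" by (intro ord) blast
    then show False using assms by (auto dest!: dvd_imp_le)
  qed
  then obtain r where r: "\<And>i. j i \<noteq> r" by (metis surjI)
  \<comment> \<open>Otherwise all powers \<open>a i ^ (d - 1)\<close> agree, and the projective
    order divides \<open>d - 1\<close>.\<close>
  have not_const: "\<exists>i. j i \<noteq> p" for p
  proof (rule ccontr)
    assume "\<not> ?thesis"
    then have "a i ^ (d - 1) = a k ^ (d - 1)" for i k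
      using eq[of i] eq[of k] nz by (metis mult_right_cancel)
    then have "l * (d - 1) dvd d - 1" by (intro ord) blast
    then show False using assms by (auto dest!: dvd_imp_le)
  qed
  \<comment> \<open>With \<open>r\<close> the index outside the image and \<open>?p\<close> its own
    image under \<open>j\<close>, the required relation between \<open>r\<close> and
    \<open>?p\<close> is an instance of \<open>eq\<close>.\<close>
  let ?p = "j r"
  obtain i where i: "j i \<noteq> ?p" using not_const by blast
  let ?q = "j i"
  have cases: "k = ?p \<or> k = ?q \<or> k = r" for k
    by (rule three_distinct) (use r[of r] r[of i] i in auto)
  have jj: "j k = ?p \<or> j k = ?q" for k using cases[of "j k"] r by blast
  have pq: "a ?q ^ l = a ?p ^ l" by (rule jl)
  have pqd: "a ?q ^ d = a ?p ^ d" using pq \<open>l dvd d\<close> by (metis dvd_def power_mult)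
  \<comment> \<open>If \<open>j\<close> fixes \<open>?p\<close>, the first alternative is
    \<open>eq\<close>. Otherwise \<open>j\<close> sends \<open>?p\<close> to \<open>?q\<close>, and
    either possible image of \<open>?q\<close> forces the squares of the two eigenvalues to agree;
    the sign decides the alternative.\<close>
  have "c = a ?p ^ d \<or> (a ?q = - a ?p \<and> c = - (a ?p ^ d))"
  proof (cases "j ?p = ?p")
    case True
    then show ?thesis using eq[of ?p] d0 by metis
  next
    case False
    then have jp: "j ?p = ?q" using jj by blast
    have cp: "a ?p ^ (d - 1) * a ?q = c" using eq[of ?p] jp by simp
    have "a ?q ^ 2 = a ?p ^ 2"
    proof (cases "j ?q = ?q")
      case True
      then have "a ?q ^ d = c" using eq[of ?q] d0 by metis
      with pqd cp d0[of ?p] nz show ?thesis by (metis mult_left_cancel power_not_zero)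
    next
      case False
      then have "j ?q = ?p" using jj by blast
      then have "a ?q ^ (d - 1) * a ?p = a ?p ^ (d - 1) * a ?q"
        using eq[of ?q] cp by simp
      then have "(a ?q ^ (d - 1) * a ?p) * (a ?p * a ?q) = (a ?p ^ (d - 1) * a ?q) * (a ?p * a ?q)"
        by simp
      then have "a ?q ^ d * a ?p ^ 2 = a ?p ^ d * a ?q ^ 2"
        unfolding d0 by (simp add: power2_eq_square ac_simps)
      then show ?thesis using pqd nz by simp
    qed
    then have "a ?q = a ?p \<or> a ?q = - a ?p" by (simp add: power2_eq_iff)
    then show ?thesis using cp d0[of ?p] by auto
  qed
  moreover have "a r ^ (d - 1) * a ?p = c" by (rule eq)
  ultimately show ?thesis using that[of ?p ?q r] r[of r] r[of i] i pq by metis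
qed

lemma eval_diagonal:
  "eval F (\<chi> i. a i * v $ i) = (\<Sum>m\<in>Poly_Mapping.keys F. Poly_Mapping.lookup F m *
     (\<Prod>i\<in>UNIV. a i ^ Poly_Mapping.lookup m i) * mon_eval m v)"
  by (simp add: eval_def mon_eval_def power_mult_distrib prod.distrib mult.assoc)

text \<open>Monomials are eigenvectors of a diagonal substitution, and they are independent, so each
  one that occurs has the eigenvalue of the whole form.\<close>

lemma diagonal_semi_invariant_keys:
  fixes F :: "'a::field_char_0 poly3"
  assumes inv: "\<And>v. eval F (\<chi> i. a i * v $ i) = c * eval F v" and m: "m \<in> Poly_Mapping.keys F"
  shows "(\<Prod>i\<in>UNIV. a i ^ Poly_Mapping.lookup m i) = c"
proof -
  let ?K = "Poly_Mapping.keys F"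
  let ?c = "\<lambda>m. Poly_Mapping.lookup F m * ((\<Prod>i\<in>UNIV. a i ^ Poly_Mapping.lookup m i) - c)"
  have "(\<Sum>m\<in>?K. ?c m * mon_eval m v) = 0" for v
  proof -
    have "(\<Sum>m\<in>?K. ?c m * mon_eval m v) = eval F (\<chi> i. a i * v $ i) - c * eval F v"
      unfolding eval_diagonal
      by (simp add: eval_superset[of ?K] algebra_simps sum_subtractf sum_distrib_left)
    with inv show ?thesis by simp
  qed
  then have "?c m = 0" by (intro sum_mon_eval_eq_0_imp[of ?K ?c]) (use m in auto)
  with m show ?thesis by (simp add: in_keys_iff)
qed

section \<open>Forms divisible by the first variable\<close>

lemma exists_binary_zero:
  fixes b c :: "'a::alg_closed_field"
  assumes "n > 0"
  obtains s t where "s \<noteq> 0 \<or> t \<noteq> 0" "b * s ^ n + c * t ^ n = 0"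
proof (cases "c = 0")
  case True
  then show ?thesis using that[of 0 1] assms by (simp add: power_0_left)
next
  case False
  obtain t where "t ^ n = - b / c" using nth_root_exists[OF assms] by blast
  then show ?thesis using that[of 1 t] False by simp
qed

definition expo3 :: "nat \<Rightarrow> nat \<Rightarrow> nat \<Rightarrow> (3 \<Rightarrow>\<^sub>0 nat)" where
  "expo3 i j k = Poly_Mapping.single 1 i + Poly_Mapping.single 2 j + Poly_Mapping.single 3 k"

lemma lookup_expo3 [simp]:
  "Poly_Mapping.lookup (expo3 i j k) 1 = i"
  "Poly_Mapping.lookup (expo3 i j k) 2 = j"
  "Poly_Mapping.lookup (expo3 i j k) 3 = k"
proof -
  have ne: "(1::3) \<noteq> 2" "(1::3) \<noteq> 3" "(2::3) \<noteq> 3" by simp_all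
  show "Poly_Mapping.lookup (expo3 i j k) 1 = i"
    "Poly_Mapping.lookup (expo3 i j k) 2 = j"
    "Poly_Mapping.lookup (expo3 i j k) 3 = k"
    unfolding expo3_def lookup_add using ne ne[symmetric]
    by (simp_all add: lookup_single_not_eq)
qed

lemma mon_eval_expo3 [simp]: "mon_eval (expo3 i j k) v = v $ 1 ^ i * v $ 2 ^ j * v $ 3 ^ k"
  unfolding mon_eval_def prod_UNIV_3 by simp

text \<open>By \<open>div\<close> the first variable splits off, and by \<open>lin\<close> the
  cofactor restricts to a binary form \<open>b s^n + c t^n\<close> on the line where this variable
  vanishes. A zero of that binary form lies on both factors, so it is a singular point.\<close>

lemma reducible_imp_singular:
  fixes F :: "'a::{alg_closed_field, field_char_0} poly3"
  assumes "n > 0"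
    and div: "\<And>m. m \<in> Poly_Mapping.keys F \<Longrightarrow> Poly_Mapping.lookup m 1 \<noteq> 0"
    and lin: "\<And>m. m \<in> Poly_Mapping.keys F \<Longrightarrow> Poly_Mapping.lookup m 1 = 1 \<Longrightarrow>
        m = expo3 1 n 0 \<or> m = expo3 1 0 n"
  shows "\<not> nonsingular F"
proof -
  let ?b = "Poly_Mapping.lookup F (expo3 1 n 0)" and ?c = "Poly_Mapping.lookup F (expo3 1 0 n)"
  obtain s t where st: "s \<noteq> 0 \<or> t \<noteq> 0" "?b * s ^ n + ?c * t ^ n = 0"
    using exists_binary_zero[OF \<open>n > 0\<close>] by blast
  let ?v = "vector [0, s, t] :: 'a ^ 3"
  have v: "?v $ 1 = 0" "?v $ 2 = s" "?v $ 3 = t" by simp_all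
  have van: "mon_eval m ?v = 0" if "Poly_Mapping.lookup m 1 \<noteq> 0" for m
    using that unfolding mon_eval_vector_3 by simp
  have "?v \<noteq> 0" using st(1) v by (metis zero_index)
  moreover have "eval F ?v = 0"
    unfolding eval_def mon_eval_def[symmetric] using van div by (simp add: sum.neutral)
  moreover have "eval (partial_deriv i F) ?v = 0" for i
  proof (cases "i = 1")
    case False
    then show ?thesis
      unfolding eval_partial_deriv
      by (intro sum.neutral) (auto simp: van lookup_minus lookup_single_not_eq div)
  next
    case True
    let ?K = "Poly_Mapping.keys F" and ?T = "{expo3 1 n 0, expo3 1 0 n}"
    let ?h = "\<lambda>m. of_nat (Poly_Mapping.lookup m 1) * Poly_Mapping.lookup F m *
       mon_eval (m - Poly_Mapping.single 1 1) ?v"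
    have minus: "expo3 1 j k - Poly_Mapping.single 1 1 = expo3 0 j k" for j k
      unfolding expo3_def by (simp add: add.assoc)
    have dist: "expo3 1 n 0 \<noteq> expo3 1 0 n"
      using \<open>n > 0\<close> by (metis lookup_expo3(2) less_irrefl)
    have zero: "?h m = 0" if "m \<in> ?K" "m \<notin> ?T" for m
    proof -
      have "Poly_Mapping.lookup (m - Poly_Mapping.single 1 1) 1 \<noteq> 0"
        using that div[of m] lin[of m] by (auto simp: lookup_minus)
      then show ?thesis by (simp add: van)
    qed
    \<comment> \<open>\<open>?T\<close> is adjoined because its two monomials need not occur in
      \<open>F\<close>.\<close>
    have "(\<Sum>m\<in>?K. ?h m) = (\<Sum>m\<in>?K \<union> ?T. ?h m)"
      by (rule sum.mono_neutral_left) (auto simp: in_keys_iff)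
    also have "\<dots> = (\<Sum>m\<in>?T. ?h m)"
      by (rule sum.mono_neutral_right) (use zero in auto)
    also have "\<dots> = ?b * s ^ n + ?c * t ^ n"
      using dist by (simp add: minus v del: One_nat_def)
    finally show ?thesis using True st(2) by (simp add: eval_partial_deriv)
  qed
  ultimately show ?thesis by (auto simp: nonsingular_def)
qed

section \<open>Automorphisms of the normal form\<close>

text \<open>Eliminating \<open>p\<close> and \<open>r\<close> from the coefficients of \<open>w\<close>, \<open>w\<^sup>2\<close> and \<open>w\<^sup>3\<close> gives
  \<open>(n choose 2)^3 = n^3 (n choose 3)\<close>, that is \<open>(n - 3) (n + 1) = 0\<close>.\<close>

lemma coeff_bordered_power_contradiction:
  fixes a b p r h h' :: "'a::field_char_0"
  assumes n: "n \<ge> 4" and "a \<noteq> 0" "b \<noteq> 0"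
    and eq: "\<And>w. a * (p + w) ^ n + h = b * (w * (1 + w * r) ^ n) + h' * w ^ Suc n"
  shows False
proof -
  let ?P = "Polynomial.smult a ([:p, 1:] ^ n) + [:h:]"
  let ?Q = "Polynomial.smult b (pCons 0 ([:1, r:] ^ n)) + Polynomial.monom h' (Suc n)"
  have "poly ?P = poly ?Q"
    by (rule ext) (use eq in \<open>simp add: poly_monom\<close>)
  then have PQ: "?P = ?Q" by (simp add: poly_eq_poly_eq_iff)
  \<comment> \<open>These are the coefficients of \<open>w ^ Suc k\<close>. The range
    \<open>1\<close> to \<open>n\<close> avoids both the constant \<open>h\<close> and the term with
    \<open>h'\<close>.\<close>
  have c: "a * (of_nat (n choose Suc k) * p ^ (n - Suc k)) = b * (of_nat (n choose k) * r ^ k)"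
    if k: "Suc k \<le> n" for k
  proof -
    have "Polynomial.coeff ?P (Suc k) = Polynomial.coeff ?Q (Suc k)" by (simp only: PQ)
    then show ?thesis
      using k by (simp add: coeff_linear_poly_power coeff_pCons split: nat.splits)
  qed
  obtain m where m: "n = m + 4" using n by (metis add.commute le_Suc_ex)
  define N where "N = (of_nat m :: 'a)"
  have n_N: "of_nat n = N + 4" by (simp add: m N_def)
  define C2 C3 where "C2 = (of_nat (n choose 2) :: 'a)" and "C3 = (of_nat (n choose 3) :: 'a)"
  have "2 * (n choose 2) = n * (n - 1)"
    unfolding choose_two by (rule dvd_mult_div_cancel) auto
  then have "of_nat (2 * (n choose 2)) = (of_nat (n * (n - 1)) :: 'a)" by presburger
  then have C2: "2 * C2 = (N + 4) * (N + 3)"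
    by (simp add: C2_def m N_def algebra_simps)
  have "3 * (n choose 3) = (n - 2) * (n choose 2)"
  proof -
    have "Suc 2 * (n choose Suc 2) = (n - 2) * (n choose 2)"
      using binomial_absorb_comp[of n 2] binomial_absorption[of 2 n] 
      by (metis Suc_times_binomial_add add_diff_inverse_nat m mult.commute)
    then show ?thesis by (simp add: numeral_eq_Suc)
  qed
  then have "of_nat (3 * (n choose 3)) = (of_nat ((n - 2) * (n choose 2)) :: 'a)" by presburger
  then have C3: "3 * C3 = (N + 2) * C2"
    by (simp add: C3_def C2_def m N_def algebra_simps)
  have 1: "a * ((N + 4) * p ^ (n - 1)) = b"
    using c[of 0] n n_N by simp
  have 2: "a * (C2 * p ^ (n - 2)) = b * ((N + 4) * r)"
    using c[of 1] n n_N by (simp add: C2_def numeral_2_eq_2)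
  have 3: "a * (C3 * p ^ (n - 3)) = b * (C2 * r ^ 2)"
    using c[of 2] n by (simp add: C2_def C3_def numeral_eq_Suc)
  have p0: "p \<noteq> 0" using 1 \<open>b \<noteq> 0\<close> n by (auto simp: power_0_left)
  define q where "q = p ^ (m + 1)"
  have q: "p ^ (n - 3) = q" "p ^ (n - 2) = q * p" "p ^ (n - 1) = q * p ^ 2"
    by (simp_all add: m q_def power_add numeral_eq_Suc ac_simps)
  have q0: "q \<noteq> 0" using p0 by (simp add: q_def)
  \<comment> \<open>The square of relation \<open>2\<close> is matched with the product of relations
    \<open>1\<close> and \<open>3\<close>; this removes \<open>b\<close> and \<open>r\<close>, and a
    common power of \<open>a * q * p\<close> then cancels.\<close>
  have "(a * (C2 * (q * p))) ^ 2 * C2 = (b * ((N + 4) * r)) ^ 2 * C2"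
    using 2 q by simp
  also have "\<dots> = b * (b * (C2 * r ^ 2)) * (N + 4) ^ 2"
    by (simp add: power2_eq_square ac_simps)
  also have "\<dots> = (a * ((N + 4) * (q * p ^ 2))) * (a * (C3 * q)) * (N + 4) ^ 2"
    using 1 3 q by simp
  finally have "(a * q * p) ^ 2 * C2 ^ 3 = (a * q * p) ^ 2 * ((N + 4) ^ 3 * C3)"
    by (simp add: power2_eq_square power3_eq_cube ac_simps)
  then have "C2 ^ 3 = (N + 4) ^ 3 * C3"
    using p0 q0 \<open>a \<noteq> 0\<close> by simp
  moreover have N: "N + of_nat k \<noteq> 0" if "k > 0" for k
    using that unfolding N_def of_nat_add[symmetric] of_nat_eq_0_iff by simp
  have C20: "C2 \<noteq> 0" using C2 N[of 4] N[of 3] by auto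
  ultimately have "3 * C2 ^ 3 = (N + 4) ^ 3 * (3 * C3)" by simp
  then have "3 * C2 ^ 2 * C2 = (N + 4) ^ 3 * (N + 2) * C2"
    unfolding C3 by (simp add: power2_eq_square power3_eq_cube ac_simps)
  then have "3 * C2 ^ 2 = (N + 4) ^ 3 * (N + 2)" using C20 by simp
  then have "3 * (2 * C2) ^ 2 = 4 * ((N + 4) ^ 3 * (N + 2))" by (simp add: power2_eq_square)
  then have "(N + 4) ^ 2 * (3 * (N + 3) ^ 2) = (N + 4) ^ 2 * (4 * ((N + 4) * (N + 2)))"
    unfolding C2 by (simp add: power2_eq_square power3_eq_cube ac_simps)
  then have "3 * (N + 3) ^ 2 = 4 * ((N + 4) * (N + 2))" using N[of 4] by simp
  \<comment> \<open>In terms of \<open>n\<close> the factors are \<open>n + 1\<close> and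
    \<open>n - 3\<close>, nonzero in characteristic zero.\<close>
  then have "(N + 5) * (N + 1) = 0" by (simp add: algebra_simps power2_eq_square)
  then show False using N[of 5] N[of 1] by simp
qed

definition binary_form :: "nat \<Rightarrow> nat set \<Rightarrow> (nat \<Rightarrow> 'a::comm_semiring_1) \<Rightarrow> 'a \<Rightarrow> 'a \<Rightarrow> 'a" where
  "binary_form d J \<beta> x y = x ^ d + y ^ d + (\<Sum>j\<in>J. \<beta> j * x ^ (d - j) * y ^ j)"

text \<open>A function of coordinate vectors rather than a \<open>poly3\<close>, since all later
  arguments compare values. The third coordinate enters only through the first summand.\<close>

definition normal_form ::
    "nat \<Rightarrow> nat set \<Rightarrow> 'a::comm_semiring_1 \<Rightarrow> (nat \<Rightarrow> 'a) \<Rightarrow> 'a ^ 3 \<Rightarrow> 'a" where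
  "normal_form d J \<alpha> \<beta> v = \<alpha> * v $ 1 * v $ 3 ^ (d - 1) + binary_form d J \<beta> (v $ 1) (v $ 2)"

lemma binary_form_scale:
  assumes "J \<subseteq> {2..d - 2}"
  shows "binary_form d J \<beta> (w * x) (w * y) = w ^ d * binary_form d J \<beta> x y"
proof -
  have "\<beta> j * (w * x) ^ (d - j) * (w * y) ^ j = w ^ d * (\<beta> j * x ^ (d - j) * y ^ j)" if "j \<in> J" for j
  proof -
    have "j \<le> d" using that assms by force
    then have "w ^ d = w ^ (d - j) * w ^ j" by (simp flip: power_add)
    then show ?thesis by (simp add: power_mult_distrib ac_simps)
  qed
  then have "(\<Sum>j\<in>J. \<beta> j * (w * x) ^ (d - j) * (w * y) ^ j)
      = (\<Sum>j\<in>J. w ^ d * (\<beta> j * x ^ (d - j) * y ^ j))"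
    by (intro sum.cong refl)
  then show ?thesis
    by (simp add: binary_form_def power_mult_distrib distrib_left sum_distrib_left)
qed

lemma binary_form_0:
  assumes "J \<subseteq> {2..d - 2}" "d \<ge> 2"
  shows "binary_form d J \<beta> 0 y = y ^ d" "binary_form d J \<beta> x 0 = x ^ d"
proof -
  have "\<beta> j * 0 ^ (d - j) * y ^ j = 0" if "j \<in> J" for j
    using that assms by (auto simp: power_0_left)
  then show "binary_form d J \<beta> 0 y = y ^ d"
    using assms(2) by (simp add: binary_form_def power_0_left)
  have "\<beta> j * x ^ (d - j) * 0 ^ j = 0" if "j \<in> J" for j
    using that assms by (auto simp: power_0_left)
  then show "binary_form d J \<beta> x 0 = x ^ d"
    using assms(2) by (simp add: binary_form_def power_0_left)
qed


lemma coeff_power_top: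
  assumes "n > 0"
  shows "Polynomial.coeff ([:a, b:] ^ n) n = b ^ n"
    "Polynomial.coeff ([:a, b:] ^ n) (n - 1) = of_nat n * b ^ (n - 1) * a"
proof -
  have "n choose (n - 1) = n"
    using assms binomial_symmetric[of "n - 1" n] by simp
  then show "Polynomial.coeff ([:a, b:] ^ n) (n - 1) = of_nat n * b ^ (n - 1) * a"
    using assms by (simp add: coeff_linear_poly_power)
qed (simp add: coeff_linear_poly_power)

lemma matrix_vector_mult_3:
  "((T :: 'a::comm_semiring_1 ^ 3 ^ 3) *v v) $ i = T $ i $ 1 * v $ 1 + T $ i $ 2 * v $ 2 + T $ i $ 3 * v $ 3"
  by (simp add: matrix_vector_mult_def sum_3)

text \<open>The point \<open>(0 : 0 : 1)\<close> is the only inner Galois point: otherwise the restriction of the form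
  to a line through this point and one of its images would have two different shapes.\<close>

lemma normal_form_automorphism_fixes_center:
  fixes T :: "'a::field_char_0 ^ 3 ^ 3"
  assumes d: "d \<ge> 5" and J: "J \<subseteq> {2..d - 2}" and "\<alpha> \<noteq> 0" and "c \<noteq> 0" and inv: "invertible T"
    and T: "\<And>v. normal_form d J \<alpha> \<beta> (T *v v) = c * normal_form d J \<alpha> \<beta> v"
  shows "T $ 1 $ 3 = 0 \<and> T $ 2 $ 3 = 0"
proof -
  let ?f = "normal_form d J \<alpha> \<beta>" and ?H = "binary_form d J \<beta>"
  obtain S where S: "T ** S = mat 1" "S ** T = mat 1" using inv by (auto simp: invertible_def)
  define e where "e = (vector [0, 0, 1] :: 'a ^ 3)"
  have e: "e $ 1 = 0" "e $ 2 = 0" "e $ 3 = 1" by (simp_all add: e_def)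
  \<comment> \<open>The image and the preimage of the centre \<open>e\<close>: the line through
    \<open>e\<close> and \<open>r\<close> is mapped to the line through \<open>p\<close> and
    \<open>e\<close>.\<close>
  define p r where "p = T *v e" and "r = S *v e"
  have pT: "p $ i = T $ i $ 3" for i by (simp add: p_def matrix_vector_mult_3 e)
  have Tr: "T *v r = e" by (simp add: r_def matrix_vector_mul_assoc S)
  have fe: "?f e = 0"
    using d by (simp add: normal_form_def e binary_form_0[OF J] power_0_left)
  \<comment> \<open>Where the first coordinate vanishes the form is just the \<open>d\<close>-th
    power of the second, so the curve meets this line only in \<open>e\<close>.\<close>
  have axis: "v $ 2 = 0" if "?f v = 0" "v $ 1 = 0" for v
    using that d by (simp add: normal_form_def binary_form_0[OF J])
  have fp: "?f p = 0" unfolding p_def T fe by simp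
  have fr: "?f r = 0" using T[of r] Tr fe \<open>c \<noteq> 0\<close> by simp
  have "p $ 1 = 0"
  proof (rule ccontr)
    assume p1: "p $ 1 \<noteq> 0"
    \<comment> \<open>Otherwise \<open>r\<close> is a multiple of \<open>e\<close>, and
      \<open>T *v r = e\<close> would be a multiple of \<open>p\<close>, whose first coordinate is
      nonzero.\<close>
    have r1: "r $ 1 \<noteq> 0"
    proof
      assume r1: "r $ 1 = 0"
      then have r2: "r $ 2 = 0" using axis fr by blast
      have "(T *v r) $ 1 = p $ 1 * r $ 3" "(T *v r) $ 3 = p $ 3 * r $ 3"
        by (simp_all add: matrix_vector_mult_3 r1 r2 pT)
      then show False using Tr e p1 by auto
    qed
    \<comment> \<open>The left side evaluates the form at \<open>p + w *s e\<close>, the right side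
      at \<open>e + w *s r\<close> and multiplies by \<open>c\<close>; on the right \<open>w\<close>
      factors out of the first two coordinates.\<close>
    have eq: "(\<alpha> * p $ 1) * (p $ 3 + w) ^ (d - 1) + ?H (p $ 1) (p $ 2) =
        (c * \<alpha> * r $ 1) * (w * (1 + w * r $ 3) ^ (d - 1)) +
        (c * ?H (r $ 1) (r $ 2)) * w ^ Suc (d - 1)" for w
    proof -
      have "T *v (e + w *s r) = p + w *s e"
        by (simp add: matrix_vector_right_distrib vector_scalar_commute Tr p_def)
      then have "?f (p + w *s e) = c * ?f (e + w *s r)" using T by metis
      moreover have "Suc (d - 1) = d" using d by simp
      ultimately show ?thesis
        by (simp add: normal_form_def e binary_form_scale[OF J] algebra_simps)
    qed
    have "4 \<le> d - 1" "\<alpha> * p $ 1 \<noteq> 0" "c * \<alpha> * r $ 1 \<noteq> 0"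
      using d p1 r1 \<open>\<alpha> \<noteq> 0\<close> \<open>c \<noteq> 0\<close> by auto
    then show False using coeff_bordered_power_contradiction eq by blast
  qed
  then show ?thesis using axis fp pT by metis
qed

text \<open>Once the centre is fixed, the two highest powers of the third coordinate determine the
  first and third rows of \<open>T\<close>. The remaining entry \<open>T $ 2 $ 1\<close> vanishes
  because the binary form has no term of degree \<open>d - 1\<close> in the second variable.\<close>

lemma normal_form_automorphism_diagonal:
  fixes T :: "'a::field_char_0 ^ 3 ^ 3"
  assumes d: "d \<ge> 5" and J: "J \<subseteq> {2..d - 2}" and "\<alpha> \<noteq> 0" and "c \<noteq> 0" and inv: "invertible T"
    and T: "\<And>v. normal_form d J \<alpha> \<beta> (T *v v) = c * normal_form d J \<alpha> \<beta> v"
  shows "\<forall>i k. i \<noteq> k \<longrightarrow> T $ i $ k = 0" "\<forall>i. T $ i $ i \<noteq> 0"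
    "(T $ 2 $ 2) ^ d = (T $ 1 $ 1) ^ d" "(T $ 3 $ 3) ^ (d - 1) = (T $ 1 $ 1) ^ (d - 1)"
proof -
  let ?f = "normal_form d J \<alpha> \<beta>" and ?H = "binary_form d J \<beta>"
  define n where "n = d - 1"
  have n: "n > 1" "Suc n = d" using d by (simp_all add: n_def)
  have z: "T $ 1 $ 3 = 0" "T $ 2 $ 3 = 0"
    using normal_form_automorphism_fixes_center[OF assms] by auto
  have inj: "v = 0" if "T *v v = 0" for v
    using inv that by (metis invertible_left_inverse matrix_left_invertible_ker)
  define p where "p = T $ 3 $ 3"
  have p0: "p \<noteq> 0"
  proof
    assume "p = 0"
    then have "T *v vector [0, 0, 1] = 0"
      using z by (simp add: vec_eq_iff forall_3 matrix_vector_mult_3 p_def)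
    then have "vector [0, 0, 1] = (0 :: 'a ^ 3)" by (rule inj)
    then have "(vector [0, 0, 1] :: 'a ^ 3) $ 3 = (0 :: 'a ^ 3) $ 3" by (rule arg_cong)
    then show False by simp
  qed
  have poly_eq: "\<alpha> * (T $ 1 $ 1 * x + T $ 1 $ 2 * y) * (T $ 3 $ 1 * x + T $ 3 $ 2 * y + p * z) ^ n
      + ?H (T $ 1 $ 1 * x + T $ 1 $ 2 * y) (T $ 2 $ 1 * x + T $ 2 $ 2 * y)
      = c * (\<alpha> * x * z ^ n + ?H x y)" for x y z
    using T[of "vector [x, y, z]"] z by (simp add: normal_form_def matrix_vector_mult_3 n_def p_def)
  \<comment> \<open>Coefficients of \<open>z ^ n\<close> and \<open>z ^ (n - 1)\<close>. As
    \<open>n > 1\<close>, the binary forms, which are constant in \<open>z\<close>, do not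
    interfere.\<close>
  have coeffs: "\<alpha> * (T $ 1 $ 1 * x + T $ 1 $ 2 * y) * p ^ n = c * \<alpha> * x"
    "(T $ 1 $ 1 * x + T $ 1 $ 2 * y) * (T $ 3 $ 1 * x + T $ 3 $ 2 * y) = 0" for x y
  proof -
    let ?a = "T $ 1 $ 1 * x + T $ 1 $ 2 * y" and ?b = "T $ 3 $ 1 * x + T $ 3 $ 2 * y"
    let ?h = "?H ?a (T $ 2 $ 1 * x + T $ 2 $ 2 * y)"
    let ?P = "Polynomial.smult (\<alpha> * ?a) ([:?b, p:] ^ n) + [:?h:]"
    let ?Q = "Polynomial.monom (c * \<alpha> * x) n + [:c * ?H x y:]"
    have "poly ?P = poly ?Q"
    proof
      fix w show "poly ?P w = poly ?Q w"
        using poly_eq[of x y w] by (simp add: poly_monom algebra_simps)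
    qed
    then have PQ: "?P = ?Q" by (simp add: poly_eq_poly_eq_iff)
    have const: "Polynomial.coeff [:x:] k = 0" if "k > 0" for x :: 'a and k
      using that by (simp add: coeff_pCons split: nat.splits)
    have "Polynomial.coeff ?P n = Polynomial.coeff ?Q n" by (simp only: PQ)
    then show "\<alpha> * ?a * p ^ n = c * \<alpha> * x"
      using n by (simp add: const coeff_power_top)
    have "Polynomial.coeff ?P (n - 1) = \<alpha> * ?a * (of_nat n * p ^ (n - 1) * ?b)"
      unfolding coeff_add coeff_smult using n by (subst coeff_power_top(2)) (simp_all add: const)
    moreover have "Polynomial.coeff ?Q (n - 1) = 0"
      unfolding coeff_add using n by (simp add: const)
    ultimately have "\<alpha> * ?a * (of_nat n * p ^ (n - 1) * ?b) = 0"
      using PQ by simp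
    then show "?a * ?b = 0"
      using n(1) p0 \<open>\<alpha> \<noteq> 0\<close> by simp
  qed
  have a: "T $ 1 $ 1 * p ^ n = c" using coeffs(1)[of 1 0] \<open>\<alpha> \<noteq> 0\<close> by simp
  then have a0: "T $ 1 $ 1 \<noteq> 0" using \<open>c \<noteq> 0\<close> by auto
  have b: "T $ 1 $ 2 = 0" using coeffs(1)[of 0 1] \<open>\<alpha> \<noteq> 0\<close> p0 by simp
  have f: "T $ 3 $ 1 = 0" using coeffs(2)[of 1 0] a0 by simp
  have g: "T $ 3 $ 2 = 0" using coeffs(2)[of 1 1] a0 b f by simp
  have e0: "T $ 2 $ 2 \<noteq> 0"
  proof
    assume "T $ 2 $ 2 = 0"
    then have "T *v vector [0, 1, 0] = 0"
      using b g by (simp add: vec_eq_iff forall_3 matrix_vector_mult_3)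
    then have "vector [0, 1, 0] = (0 :: 'a ^ 3)" by (rule inj)
    then have "(vector [0, 1, 0] :: 'a ^ 3) $ 2 = (0 :: 'a ^ 3) $ 2" by (rule arg_cong)
    then show False by simp
  qed
  have H: "?H (T $ 1 $ 1 * x) (T $ 2 $ 1 * x + T $ 2 $ 2 * y) = c * ?H x y" for x y
    using poly_eq[of x y 0] n b f g by (simp add: power_0_left)
  \<comment> \<open>At \<open>x = 1\<close> the coefficient of \<open>y ^ (d - 1)\<close> is
    compared: all \<open>j\<close> in \<open>J\<close> are at most \<open>d - 2\<close>, so only the
    \<open>d\<close>-th power of the second row contributes.\<close>
  have c': "T $ 2 $ 1 = 0"
  proof -
    let ?L = "[:T $ 2 $ 1, T $ 2 $ 2:]"
    let ?P = "[:T $ 1 $ 1 ^ d:] + ?L ^ d + (\<Sum>j\<in>J. Polynomial.smult (\<beta> j * T $ 1 $ 1 ^ (d - j)) (?L ^ j))"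
    let ?Q = "Polynomial.smult c ([:1:] + Polynomial.monom 1 d + (\<Sum>j\<in>J. Polynomial.monom (\<beta> j) j))"
    have "poly ?P = poly ?Q"
    proof
      fix w show "poly ?P w = poly ?Q w"
        using H[of 1 w] by (simp add: poly_monom poly_sum binary_form_def algebra_simps)
    qed
    then have "?P = ?Q" by (simp add: poly_eq_poly_eq_iff)
    then have PQ: "Polynomial.coeff ?P n = Polynomial.coeff ?Q n" by simp
    have low: "j < n" if "j \<in> J" for j using that J d by (force simp: n_def)
    have "Polynomial.coeff (?L ^ j) n = 0" if "j \<in> J" for j
    proof (rule coeff_eq_0)
      have "Polynomial.degree (?L ^ j) \<le> Polynomial.degree ?L * j" by (rule degree_power_le)
      also have "\<dots> \<le> j" by simp
      also have "\<dots> < n" by (rule low[OF that])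
      finally show "Polynomial.degree (?L ^ j) < n" .
    qed
    then have "(\<Sum>j\<in>J. Polynomial.coeff (Polynomial.smult (\<beta> j * T $ 1 $ 1 ^ (d - j)) (?L ^ j)) n) = 0"
      by (intro sum.neutral) simp
    moreover have "(\<Sum>j\<in>J. Polynomial.coeff (Polynomial.monom (\<beta> j) j) n) = 0"
      using low by (intro sum.neutral) auto
    moreover have "Polynomial.coeff [:x:] n = 0" for x :: 'a
      using n by (simp add: coeff_pCons split: nat.splits)
    moreover have "Polynomial.coeff (?L ^ d) n = of_nat d * T $ 2 $ 2 ^ n * T $ 2 $ 1"
      using d unfolding n_def by (intro coeff_power_top(2)) simp
    moreover have "Polynomial.coeff (Polynomial.monom (1::'a) d) n = 0" using n by simp
    ultimately have "of_nat d * T $ 2 $ 2 ^ n * T $ 2 $ 1 = 0"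
      using PQ by (simp add: coeff_sum del: coeff_pCons_0)
    then show ?thesis using e0 d by simp
  qed
  have "(T $ 1 $ 1) ^ d = c" using H[of 1 0] d c' by (simp add: binary_form_0[OF J])
  moreover have "(T $ 2 $ 2) ^ d = c" using H[of 0 1] d by (simp add: binary_form_0[OF J])
  moreover have "(T $ 1 $ 1) ^ d = T $ 1 $ 1 * T $ 1 $ 1 ^ n" by (simp flip: n(2))
  ultimately show "(T $ 2 $ 2) ^ d = (T $ 1 $ 1) ^ d" "(T $ 3 $ 3) ^ (d - 1) = (T $ 1 $ 1) ^ (d - 1)"
    using a a0 by (auto simp: p_def n_def)
  show "\<forall>i k. i \<noteq> k \<longrightarrow> T $ i $ k = 0"
    using z b f g c' by (auto simp: forall_3)
  show "\<forall>i. T $ i $ i \<noteq> 0"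
    using a0 e0 p0 by (simp add: forall_3 p_def)
qed

section \<open>Diagonalisation of matrices of finite projective order\<close>

lemma rsquarefree_monom_diff_const:
  fixes c :: "'a::field_char_0"
  assumes "n > 0" "c \<noteq> 0"
  shows "rsquarefree (Polynomial.monom 1 n - [:c:])"
  unfolding rsquarefree_roots
  using assms by (auto simp: poly_monom pderiv_diff pderiv_monom pderiv_pCons)

lemma degree_monom_diff_const:
  fixes c :: "'a::field_char_0"
  assumes "n > 0"
  shows "Polynomial.degree (Polynomial.monom 1 n - [:c:]) = n"
  unfolding diff_conv_add_uminus
  by (subst degree_add_eq_left) (use assms in \<open>auto simp: degree_monom_eq\<close>)

lemma proots_prod_mset_linear:
  fixes R :: "'a::idom multiset"
  shows "proots (\<Prod>x\<in>#R. [:-x, 1:]) = R"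
proof (induction R)
  case (add x R)
  have "(\<Prod>x\<in>#R. [:-x, 1:]) \<noteq> 0"
    by (auto simp: prod_mset_zero_iff)
  then have "proots ([:-x, 1:] * (\<Prod>x\<in>#R. [:-x, 1:])) = {#x#} + R"
    by (subst proots_mult) (simp_all add: add.IH)
  then show ?case by (simp del: mult_pCons_left)
qed simp

text \<open>The polynomial \<open>x^n - c\<close> splits into \<open>n\<close> linear factors and is
  squarefree, so its roots are distinct.\<close>

lemma card_nth_roots_alg_closed:
  fixes c :: "'a::{alg_closed_field, field_char_0}"
  assumes "n > 0" "c \<noteq> 0"
  shows "finite {x. x ^ n = c}" "card {x. x ^ n = c} = n"
proof -
  let ?p = "Polynomial.monom 1 n - [:c:]"
  have sf: "rsquarefree ?p" by (rule rsquarefree_monom_diff_const[OF assms])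
  then have p0: "?p \<noteq> 0" by (simp add: rsquarefree_def)
  have deg: "Polynomial.degree ?p = n"
    by (rule degree_monom_diff_const[OF assms(1)])
  have roots: "{x. poly ?p x = 0} = {x. x ^ n = c}"
    by (auto simp: poly_monom)
  show "finite {x. x ^ n = c}"
    using poly_roots_finite[OF p0] unfolding roots .
  obtain R where R: "size R = Polynomial.degree ?p" "?p = Polynomial.smult (Polynomial.lead_coeff ?p) (\<Prod>x\<in>#R. [:-x, 1:])"
    using alg_closed_imp_factorization[OF p0] by blast
  have "proots ?p = R"
  proof -
    have "proots ?p = proots (\<Prod>x\<in>#R. [:-x, 1:])"
      using p0 by (subst R(2), intro proots_smult) (metis leading_coeff_0_iff)
    also have "\<dots> = R"
      by (rule proots_prod_mset_linear)
    finally show ?thesis .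
  qed
  then have "n = size (proots ?p)" using R(1) deg by simp
  also have "\<dots> = (\<Sum>x\<in>{x. poly ?p x = 0}. Polynomial.order x ?p)"
    unfolding size_multiset_overloaded_eq
    by (rule sum.cong) (simp_all only: set_count_proots[OF p0] count_proots[OF p0])
  also have "\<dots> = (\<Sum>x\<in>{x. poly ?p x = 0}. 1)"
    by (intro sum.cong refl rsquarefree_root_order[OF sf _ p0]) simp
  finally show "card {x. x ^ n = c} = n"
    unfolding roots by simp
qed

lemma finite_power_eq: 
  fixes c :: "'a::field_char_0"
  assumes "n > 0"
  shows "finite {x. x ^ n = c} \<and> card {x. x ^ n = c} \<le> n"
proof -
  let ?p = "Polynomial.monom 1 n - [:c:]"
  have deg: "Polynomial.degree ?p = n"
    by (rule degree_monom_diff_const[OF assms(1)])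
  then have p0: "?p \<noteq> 0" using assms by force
  have roots: "{x. poly ?p x = 0} = {x. x ^ n = c}"
    by (auto simp: poly_monom)
  show ?thesis
    using poly_roots_finite[OF p0] card_poly_roots_bound[OF p0] deg unfolding roots by simp
qed

text \<open>As \<open>i < n\<close>, some \<open>n\<close>-th root of unity \<open>w\<close> has
  \<open>w ^ i \<noteq> 1\<close>. Multiplication by \<open>w\<close> permutes the roots of
  \<open>c\<close> but multiplies the sum by a factor different from \<open>1\<close>.\<close>

lemma sum_roots_of_unity_power:
  fixes c :: "'a::{alg_closed_field, field_char_0}"
  assumes "n > 0" "0 < i" "i < n" "c \<noteq> 0"
  shows "(\<Sum>x | x ^ n = c. inverse x ^ i) = 0"
proof -
  have "\<exists>w. w ^ n = 1 \<and> w ^ i \<noteq> (1::'a)"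
  proof (rule ccontr)
    assume "\<not> ?thesis"
    then have "{x. x ^ n = 1} \<subseteq> {x. x ^ i = (1::'a)}" by auto
    then have "card {x. x ^ n = (1::'a)} \<le> card {x. x ^ i = (1::'a)}"
      using finite_power_eq[of i "1::'a"] \<open>0 < i\<close> by (intro card_mono) auto
    then show False
      using card_nth_roots_alg_closed[of n "1::'a"] finite_power_eq[of i "1::'a"] assms by simp
  qed
  then obtain w :: 'a where w: "w ^ n = 1" "w ^ i \<noteq> 1" by blast
  have w0: "w \<noteq> 0" using w(1) assms(1) by (auto simp: power_0_left)
  have "(\<Sum>x | x ^ n = c. inverse x ^ i) = (\<Sum>x | x ^ n = c. inverse (w * x) ^ i)"
    by (rule sum.reindex_bij_witness[of _ "\<lambda>x. w * x" "\<lambda>x. x / w"])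
       (use w w0 in \<open>auto simp: power_mult_distrib power_divide\<close>)
  also have "\<dots> = inverse w ^ i * (\<Sum>x | x ^ n = c. inverse x ^ i)"
    by (simp add: sum_distrib_left power_mult_distrib)
  finally have "(inverse w ^ i - 1) * (\<Sum>x | x ^ n = c. inverse x ^ i) = 0"
    by (simp add: algebra_simps)
  moreover have "inverse w ^ i \<noteq> 1" using w by (simp add: power_inverse)
  ultimately show ?thesis by simp
qed

text \<open>For an \<open>n\<close>-th root \<open>x\<close> of \<open>c\<close>, the average of the vectors \<open>x^(-i) A^i v\<close> is the component of \<open>v\<close>
  in the eigenspace of \<open>x\<close>.\<close>

lemma power_scalar_imp_span_eigenvectors:
  fixes A :: "'a::{alg_closed_field, field_char_0} ^ 'n ^ 'n"
  assumes "n > 0" "c \<noteq> 0" and pow: "\<And>v. ((*v) A ^^ n) v = c *s v"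
  shows "vec.span {v. \<exists>x. A *v v = x *s v} = UNIV"
proof -
  let ?f = "(*v) A"
  let ?R = "{x. x ^ n = c}"
  \<comment> \<open>The sum is left undivided; the factor \<open>n\<close> is removed at the
    end.\<close>
  define E where "E x v = (\<Sum>i<n. inverse x ^ i *s ((?f ^^ i) v))" for x v
  have eig: "A *v E x v = x *s E x v" if x: "x ^ n = c" for x v
  proof -
    have x0: "x \<noteq> 0" using x assms by (auto simp: power_0_left)
    define g where "g i = inverse x ^ i *s ((?f ^^ i) v)" for i
    have "A *v E x v = (\<Sum>i<n. x *s g (Suc i))"
      unfolding E_def g_def vec.linear_sum[OF matrix_vector_mul_linear_gen]
      by (rule sum.cong) (use x0 in \<open>auto simp: vector_scalar_commute vector_smult_assoc\<close>)
    also have "\<dots> = x *s (\<Sum>i<n. g (Suc i))"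
      by (simp add: vec.scale_sum_right)
    \<comment> \<open>The shifted sum differs only in its end terms, which agree because the
      \<open>n\<close>-th iterate multiplies by \<open>c = x ^ n\<close>.\<close>
    also have "(\<Sum>i<n. g (Suc i)) = (\<Sum>i<n. g i) + g n - g 0"
      using sum.lessThan_Suc_shift[of g n] sum.lessThan_Suc[of g n] by (simp add: algebra_simps)
    also have "g n = g 0"
      unfolding g_def using pow[of v] x assms by (simp add: vector_smult_assoc power_inverse)
    finally show ?thesis by (simp add: E_def g_def)
  qed
  have total: "(\<Sum>x\<in>?R. E x v) = of_nat n *s v" for v
  proof -
    \<comment> \<open>After exchanging the sums, each term with \<open>0 < i\<close> contains a
      vanishing sum over the roots of \<open>c\<close>; the term \<open>i = 0\<close> counts these
      roots.\<close>
    have "(\<Sum>x\<in>?R. E x v) = (\<Sum>i<n. (\<Sum>x\<in>?R. inverse x ^ i) *s ((?f ^^ i) v))"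
      unfolding E_def by (subst sum.swap) (simp add: vec.scale_sum_left)
    also have "\<dots> = (\<Sum>i<n. if i = 0 then of_nat n *s v else 0)"
      by (rule sum.cong)
         (use assms sum_roots_of_unity_power[of n] card_nth_roots_alg_closed[of n c] in auto)
    also have "\<dots> = of_nat n *s v" using assms(1) by simp
    finally show ?thesis .
  qed
  have "v \<in> vec.span {v. \<exists>x. A *v v = x *s v}" for v
  proof -
    have "v = inverse (of_nat n) *s (\<Sum>x\<in>?R. E x v)"
      using assms(1) by (simp add: total vector_smult_assoc)
    also have "\<dots> \<in> vec.span {v. \<exists>x. A *v v = x *s v}"
      by (intro vec.span_scale vec.span_sum vec.span_base) (use eig in blast)
    finally show ?thesis .
  qed
  then show ?thesis by blast
qed

text \<open>The eigenvectors span, so a basis can be chosen among them; its members are the columns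
  of \<open>P\<close>.\<close>

lemma power_scalar_imp_diagonalizable:
  fixes A :: "'a::{alg_closed_field, field_char_0} ^ 'n ^ 'n"
  assumes "n > 0" "c \<noteq> 0" and pow: "\<And>v. ((*v) A ^^ n) v = c *s v"
  obtains P :: "'a ^ 'n ^ 'n" and a where "invertible P"
    "\<And>v. A *v (P *v v) = P *v (\<chi> i. a i * v $ i)"
proof -
  let ?S = "{v. \<exists>x. A *v v = x *s v}"
  obtain B where B: "B \<subseteq> ?S" "vec.independent B" "?S \<subseteq> vec.span B"
    using vec.maximal_independent_subset[of ?S] by blast
  have "vec.span ?S \<subseteq> vec.span B"
    by (rule vec.span_minimal[OF B(3) vec.subspace_span])
  then have span: "vec.span B = UNIV"
    unfolding power_scalar_imp_span_eigenvectors[OF assms] by blast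
  have fin: "finite B" using B(2) by (rule vec.finiteI_independent)
  have "card B = CARD('n)"
    using vec.dim_eq_card[of B UNIV] span B(2) vec_dim_card[where 'a='a and 'n='n] by simp
  then obtain b where b: "bij_betw b (UNIV::'n set) B"
    using finite_same_card_bij[of "UNIV::'n set" B] fin by auto
  then have bB: "b i \<in> B" for i by (auto simp: bij_betw_def)
  then have "\<exists>x. A *v b i = x *s b i" for i using B(1) by blast
  then obtain a where a: "A *v b i = a i *s b i" for i by metis
  define P :: "'a ^ 'n ^ 'n" where "P = (\<chi> i j. b j $ i)"
  have col: "column j P = b j" for j
    by (simp add: P_def column_def)
  have "columns P = B"
    using b by (auto simp: columns_def col bij_betw_def)
  then have "\<exists>Q. P ** Q = mat 1"
    unfolding matrix_right_invertible_span_columns by (simp add: span)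
  then have inv: "invertible P" by (simp add: invertible_right_inverse)
  have Pv: "P *v v = (\<Sum>i\<in>UNIV. v $ i *s b i)" for v
    by (simp add: matrix_mult_sum col)
  have "A *v (P *v v) = P *v (\<chi> i. a i * v $ i)" for v
    unfolding Pv vec.linear_sum[OF matrix_vector_mul_linear_gen]
    by (simp add: vector_scalar_commute a vector_smult_assoc mult.commute)
  with inv show ?thesis by (rule that)
qed

section \<open>Normal coordinates\<close>

text \<open>The \<open>N\<close>-th power of \<open>A\<close> is a scalar, nonzero by injectivity,
  so \<open>A\<close> is diagonalisable. In eigencoordinates a power is scalar exactly when the
  powers of all \<open>a i\<close> coincide, which carries the projective order over.\<close>

lemma diagonal_coordinates:
  fixes A :: "'a::{alg_closed_field, field_char_0} ^ 3 ^ 3"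
  assumes "N > 0" and "invertible A"
    and ord: "\<And>n. (\<exists>t. \<forall>v. ((*v) A ^^ n) v = t *s v) \<longleftrightarrow> N dvd n"
  obtains P :: "'a ^ 3 ^ 3" and a where
    "invertible P" "\<And>v. A *v (P *v v) = P *v (\<chi> i. a i * v $ i)" "\<And>i. a i \<noteq> 0" "\<And>n. (\<exists>t. \<forall>i. a i ^ n = t) \<longleftrightarrow> N dvd n"
proof -
  obtain t where t: "\<And>v. ((*v) A ^^ N) v = t *s v" using ord[of N] by auto
  have inj: "v = 0" if "A *v v = 0" for v
    using assms(2) that by (metis invertible_left_inverse matrix_left_invertible_ker)
  have ne: "((*v) A ^^ n) v \<noteq> 0" if "v \<noteq> 0" for v n
  proof (induction n)
    case (Suc n)
    have "A *v (((*v) A ^^ n) v) \<noteq> 0" using Suc inj by blast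
    then show ?case by simp
  qed (use that in simp)
  have t0: "t \<noteq> 0"
  proof
    assume "t = 0"
    then have "((*v) A ^^ N) (axis 1 1) = 0" unfolding t by (simp only: vec.scale_zero_left)
    moreover have "axis 1 1 \<noteq> (0 :: 'a ^ 3)" by (simp only: axis_eq_0_iff) simp
    ultimately show False using ne by blast
  qed
  obtain P :: "'a ^ 3 ^ 3" and a where P: "invertible P" and diag: "\<And>v. A *v (P *v v) = P *v (\<chi> i. a i * v $ i)"
    using power_scalar_imp_diagonalizable[OF \<open>N > 0\<close> t0 t] by blast
  obtain Q where Q: "P ** Q = mat 1" "Q ** P = mat 1" using P by (auto simp: invertible_def)
  have PQ: "P *v (Q *v w) = w" "Q *v (P *v w) = w" for w
    by (simp_all add: matrix_vector_mul_assoc Q)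
  have pow: "((*v) A ^^ n) (P *v v) = P *v (\<chi> i. a i ^ n * v $ i)" for n v
    by (induction n) (simp_all add: diag mult.assoc)
  have sc: "(\<forall>v. ((*v) A ^^ n) v = s *s v) \<longleftrightarrow> (\<forall>i. a i ^ n = s)" for n s
  proof
    assume *: "\<forall>v. ((*v) A ^^ n) v = s *s v"
    \<comment> \<open>The vector of ones exposes all entries \<open>a i ^ n\<close> at once.\<close>
    let ?o = "(\<chi> i. 1) :: 'a ^ 3"
    have "P *v (\<chi> i. a i ^ n * ?o $ i) = P *v (s *s ?o)"
      using pow[of n ?o] * by (simp add: vector_scalar_commute)
    then have "(\<chi> i. a i ^ n * ?o $ i) = s *s ?o" using PQ(2) by metis
    then show "\<forall>i. a i ^ n = s" by (simp add: vec_eq_iff)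
  next
    assume *: "\<forall>i. a i ^ n = s"
    have "((*v) A ^^ n) (P *v v) = s *s (P *v v)" for v
    proof -
      have "(\<chi> i. a i ^ n * v $ i) = s *s v" using * by (simp add: vec_eq_iff)
      then show ?thesis by (simp add: pow vector_scalar_commute)
    qed
    then show "\<forall>v. ((*v) A ^^ n) v = s *s v" using PQ(1) by metis
  qed
  have "a i \<noteq> 0" for i
    using sc[of N t] t t0 \<open>N > 0\<close> by (metis power_0_left neq0_conv)
  moreover have "(\<exists>t. \<forall>i. a i ^ n = t) \<longleftrightarrow> N dvd n" for n
    using ord[of n] sc[of n] by blast
  ultimately show ?thesis using that P diag by blast
qed

text \<open>The columns of \<open>P\<close> are eigenvectors; permuting them permutes the
  eigenvalues.\<close>

lemma permute_diagonal_coordinates: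
  fixes P :: "'a::field ^ 3 ^ 3" and \<pi> :: "3 \<Rightarrow> 3"
  assumes "invertible P" "\<And>v. A *v (P *v v) = P *v (\<chi> i. a i * v $ i)" "bij \<pi>"
  obtains P' :: "'a ^ 3 ^ 3" where "invertible P'" "\<And>v. A *v (P' *v v) = P' *v (\<chi> i. a (\<pi> i) * v $ i)"
proof
  let ?P = "(\<chi> i k. P $ i $ \<pi> k) :: 'a ^ 3 ^ 3"
  have P: "?P *v v = P *v (\<chi> i. v $ inv_into UNIV \<pi> i)" for v
  proof -
    have "(\<Sum>k\<in>UNIV. P $ i $ \<pi> k * v $ k) = (\<Sum>k\<in>UNIV. P $ i $ k * v $ inv_into UNIV \<pi> k)" for i
      using sum.reindex_bij_betw[of \<pi> UNIV UNIV "\<lambda>k. P $ i $ k * v $ inv_into UNIV \<pi> k"] assms(3)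
      by (simp add: bij_is_inj)
    then show ?thesis by (simp add: matrix_vector_mult_def)
  qed
  have "v = 0" if "?P *v v = 0" for v
  proof -
    have "(\<chi> i. v $ inv_into UNIV \<pi> i) = (0 :: 'a ^ 3)"
      using that assms(1) unfolding P by (metis invertible_left_inverse matrix_left_invertible_ker)
    then have "v $ inv_into UNIV \<pi> (\<pi> k) = 0" for k by (simp add: vec_eq_iff)
    then show ?thesis using assms(3) by (simp add: vec_eq_iff bij_is_inj)
  qed
  then show "invertible ?P"
    unfolding invertible_left_inverse matrix_left_invertible_ker by blast
  show "A *v (?P *v v) = ?P *v (\<chi> i. a (\<pi> i) * v $ i)" for v
    using assms(3) by (simp add: P assms(2) bij_is_surj surj_f_inv_f)
qed

lemma semi_invariant_normal_coordinates:
  fixes F :: "'a::{alg_closed_field, field_char_0} poly3"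
  assumes d: "d \<ge> 5" and l: "l \<ge> 2" "l dvd d"
    and hom: "homogeneous d F" and ns: "nonsingular F"
    and A: "invertible A" "carries A F F"
    and ord: "\<And>n. (\<exists>t. \<forall>v. ((*v) A ^^ n) v = t *s v) \<longleftrightarrow> l * (d - 1) dvd n"
  obtains P :: "'a ^ 3 ^ 3" and x y c where "invertible P"
    "\<And>v. eval F (P *v (vector [v $ 1, x * v $ 2, y * v $ 3])) = c * eval F (P *v v)"
    "x ^ l = 1" "y ^ (d - 1) = c" "c = 1 \<or> (x = -1 \<and> c = -1)"
    "\<And>n. x ^ n = 1 \<Longrightarrow> y ^ n = 1 \<Longrightarrow> l * (d - 1) dvd n"
proof -
  let ?N = "l * (d - 1)"
  have N: "?N > 0" using d l by simp
  obtain c where c: "c \<noteq> 0" "\<And>v. eval F (A *v v) = c * eval F v"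
    using A(2) unfolding carries_iff by blast
  obtain P0 :: "'a ^ 3 ^ 3" and a where P0: "invertible P0" "\<And>v. A *v (P0 *v v) = P0 *v (\<chi> i. a i * v $ i)"
    and a0: "\<And>i. a i \<noteq> 0" and a: "\<And>n. (\<exists>t. \<forall>i. a i ^ n = t) \<longleftrightarrow> ?N dvd n"
    using diagonal_coordinates[OF N A(1) ord] by blast
  let ?G = "lin_subst P0 F"
  have G: "nonsingular ?G" "homogeneous d ?G"
    using nonsingular_lin_subst[OF P0(1) ns] homogeneous_lin_subst[OF hom] by auto
  have "\<forall>i. \<exists>j. Poly_Mapping.single i (d - 1) + Poly_Mapping.single j 1 \<in> Poly_Mapping.keys ?G"
    using nonsingular_imp_monomial[OF G] d by auto
  then obtain j where j: "\<And>i. Poly_Mapping.single i (d - 1) + Poly_Mapping.single (j i) 1 \<in> Poly_Mapping.keys ?G"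
    by metis
  \<comment> \<open>Each monomial forced by nonsingularity has eigenvalue \<open>c\<close>.\<close>
  have eq: "a i ^ (d - 1) * a (j i) = c" for i
  proof -
    have "(\<Prod>k\<in>UNIV. a k ^ Poly_Mapping.lookup
        (Poly_Mapping.single i (d - 1) + Poly_Mapping.single (j i) 1) k) = c"
      by (rule diagonal_semi_invariant_keys[OF _ j]) (simp add: eval_lin_subst c flip: P0(2))
    then have "mon_eval (Poly_Mapping.single i (d - 1) + Poly_Mapping.single (j i) 1) (\<chi> k. a k) = c"
      by (simp add: mon_eval_def)
    then show ?thesis by (simp add: mon_eval_add mon_eval_single)
  qed
  have per: "a i ^ ?N = a k ^ ?N" for i k using a[of ?N] by (metis dvd_refl)
  obtain p q r where pqr: "p \<noteq> q" "p \<noteq> r" "q \<noteq> r" "a q ^ l = a p ^ l" "a r ^ (d - 1) * a p = c"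
    "c = a p ^ d \<or> (a q = - a p \<and> c = - (a p ^ d))"
    by (rule exists_eigenvalue_pattern[of d l a j c]) (use d l a0 eq a per in auto)
  define \<pi> where "\<pi> = (\<lambda>i::3. if i = 1 then p else if i = 2 then q else r)"
  have ne: "(1::3) \<noteq> 2" "(1::3) \<noteq> 3" "(2::3) \<noteq> 3" by simp_all
  have pi: "\<pi> 1 = p" "\<pi> 2 = q" "\<pi> 3 = r"
    unfolding \<pi>_def using ne by presburger+
  have "surj \<pi>"
    using three_distinct[OF pqr(1,2,3)] pi by (metis surjI surj_def)
  then have "bij \<pi>" by (simp add: bij_def finite_UNIV_surj_inj)
  then obtain P :: "'a ^ 3 ^ 3" where P: "invertible P" "\<And>v. A *v (P *v v) = P *v (\<chi> i. a (\<pi> i) * v $ i)"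
    using permute_diagonal_coordinates[OF P0] by blast
  \<comment> \<open>Dividing all eigenvalues by \<open>a p\<close> does not change the projective
    map; by homogeneity it replaces \<open>c\<close> by \<open>c / a p ^ d\<close>.\<close>
  define x y where "x = a q / a p" and "y = a r / a p"
  have dd: "a p ^ d = a p ^ (d - 1) * a p" using d by (metis Suc_diff_1 less_le_trans power_Suc2 zero_less_numeral)
  show ?thesis
  proof
    show "invertible P" by (rule P(1))
    show "eval F (P *v (vector [v $ 1, x * v $ 2, y * v $ 3])) = c / a p ^ d * eval F (P *v v)" for v
    proof -
      have "a p *s vector [v $ 1, x * v $ 2, y * v $ 3] = (\<chi> i. a (\<pi> i) * v $ i)"
        using a0 by (simp add: vec_eq_iff forall_3 pi x_def y_def)
      then have "a p *s (P *v (vector [v $ 1, x * v $ 2, y * v $ 3])) = A *v (P *v v)"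
        unfolding P(2) by (simp only: flip: vector_scalar_commute)
      then have "eval F (a p *s (P *v (vector [v $ 1, x * v $ 2, y * v $ 3]))) = c * eval F (P *v v)"
        by (simp only: c(2))
      then have "a p ^ d * eval F (P *v (vector [v $ 1, x * v $ 2, y * v $ 3])) = c * eval F (P *v v)"
        using hom unfolding homogeneous_iff by simp
      then show ?thesis using a0 by (simp add: field_simps)
    qed
    show "x ^ l = 1" using pqr(4) a0 by (simp add: x_def power_divide)
    show "y ^ (d - 1) = c / a p ^ d"
      unfolding pqr(5)[symmetric] dd y_def using a0 by (simp add: power_divide)
    show "c / a p ^ d = 1 \<or> (x = -1 \<and> c / a p ^ d = -1)"
      using pqr(6) a0 by (auto simp: x_def)
    show "?N dvd n" if "x ^ n = 1" "y ^ n = 1" for n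
    proof -
      have "a q ^ n = a p ^ n" "a r ^ n = a p ^ n"
        using that a0 by (simp_all add: x_def y_def power_divide)
      then have "\<forall>i. a i ^ n = a p ^ n"
        using three_distinct[OF pqr(1,2,3)] by metis
      then show ?thesis using a by blast
    qed
  qed
qed

text \<open>After \<open>c = -1\<close> is excluded, an occurring monomial with exponents
  \<open>j\<close>, \<open>k\<close> in the last two variables satisfies \<open>x^j y^k = 1\<close>.
  The order condition separates this into \<open>l dvd j\<close> and \<open>d - 1 dvd k\<close>, and
  the degree bounds leave the listed monomials.\<close>

lemma homogeneous_normal_monomials:
  fixes G :: "'a::{alg_closed_field, field_char_0} poly3"
  assumes d: "d \<ge> 5" and l: "l \<ge> 2" "l dvd d"
    and hom: "homogeneous d G" and ns: "nonsingular G"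
    and inv: "\<And>v. eval G (vector [v $ 1, x * v $ 2, y * v $ 3]) = c * eval G v"
    and x: "x ^ l = 1" and y: "y ^ (d - 1) = c" and c: "c = 1 \<or> (x = -1 \<and> c = -1)"
    and ord: "\<And>n. x ^ n = 1 \<Longrightarrow> y ^ n = 1 \<Longrightarrow> l * (d - 1) dvd n"
    and m: "m \<in> Poly_Mapping.keys G"
  shows "m = expo3 1 0 (d - 1) \<or> (\<exists>j. l dvd j \<and> j \<le> d \<and> m = expo3 (d - j) j 0)"
proof -
  have key: "x ^ Poly_Mapping.lookup m 2 * y ^ Poly_Mapping.lookup m 3 = c"
    and deg: "Poly_Mapping.lookup m 1 + Poly_Mapping.lookup m 2 + Poly_Mapping.lookup m 3 = d"
    if m: "m \<in> Poly_Mapping.keys G" for m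
  proof -
    define a where "a = (\<lambda>i::3. vector [1, x, y] $ i)"
    have a: "a 1 = 1" "a 2 = x" "a 3 = y" by (simp_all add: a_def)
    have "(\<chi> i. a i * v $ i) = vector [v $ 1, x * v $ 2, y * v $ 3]" for v
      by (simp add: vec_eq_iff forall_3 a)
    then have "(\<Prod>i\<in>UNIV. a i ^ Poly_Mapping.lookup m i) = c"
      by (intro diagonal_semi_invariant_keys[OF _ m]) (simp add: inv)
    then show "x ^ Poly_Mapping.lookup m 2 * y ^ Poly_Mapping.lookup m 3 = c"
      by (simp add: prod_UNIV_3 a)
    show "Poly_Mapping.lookup m 1 + Poly_Mapping.lookup m 2 + Poly_Mapping.lookup m 3 = d"
      using hom m by (simp add: homogeneous_def sum_3)
  qed
  \<comment> \<open>For \<open>c = -1\<close> both \<open>x\<close> and \<open>y\<close> have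
    trivial \<open>2 * (d - 1)\<close>-th power, so \<open>l = 2\<close> and \<open>d\<close> is
    even. Then the first variable divides every monomial, against nonsingularity.\<close>
  have "c = 1"
  proof (rule ccontr)
    assume "c \<noteq> 1"
    then have x1: "x = -1" and c1: "c = -1" using c by auto
    have "y ^ (2 * (d - 1)) = (y ^ (d - 1)) ^ 2"
      by (simp add: mult.commute flip: power_mult)
    then have "x ^ (2 * (d - 1)) = 1" "y ^ (2 * (d - 1)) = 1"
      unfolding y by (simp_all add: x1 c1)
    then have "l * (d - 1) dvd 2 * (d - 1)" by (rule ord)
    then have "l dvd 2" using d by simp
    then have l2: "l = 2" using l(1) by (simp add: dvd_imp_le le_antisym)
    have k: "Poly_Mapping.lookup m 3 = 0 \<or> Poly_Mapping.lookup m 3 = d - 1"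
      if m: "m \<in> Poly_Mapping.keys G" for m
    proof -
      let ?k = "Poly_Mapping.lookup m 3" and ?j = "Poly_Mapping.lookup m 2"
      \<comment> \<open>Squaring removes the sign \<open>x ^ ?j\<close>; since \<open>l = 2\<close>,
        the order condition makes \<open>d - 1\<close> divide \<open>?k\<close>.\<close>
      have "(x ^ ?j * y ^ ?k) ^ 2 = 1" using key[OF m] by (simp add: c1)
      moreover have "(x ^ ?j) ^ 2 = 1" by (simp add: x1 flip: power_mult)
      ultimately have "y ^ (2 * ?k) = 1" by (simp add: power_mult_distrib power_mult mult.commute[of 2])
      moreover have "x ^ (2 * ?k) = 1" by (simp add: x1)
      ultimately have "l * (d - 1) dvd 2 * ?k" by (intro ord)
      then have "d - 1 dvd ?k" by (simp add: l2)
      then obtain e where e: "?k = (d - 1) * e" by blast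
      have "e < 2"
      proof (rule ccontr)
        assume "\<not> e < 2"
        then have "?k \<ge> (d - 1) * 2" unfolding e by (intro mult_le_mono2) simp
        then show False using deg[OF m] d by simp
      qed
      then show ?thesis using e by (cases e) auto
    qed
    have "\<not> nonsingular G"
    proof (rule reducible_imp_singular)
      show "d - 1 > 0" using d by simp
      fix m assume m: "m \<in> Poly_Mapping.keys G"
      have "even d" using l(2) l2 by simp
      \<comment> \<open>The candidates without the first variable are \<open>Y^d\<close> and
        \<open>Y Z^(d-1)\<close>; both have eigenvalue \<open>1\<close>, the former because
        \<open>d\<close> is even.\<close>
      show "Poly_Mapping.lookup m 1 \<noteq> 0"
      proof
        assume m1: "Poly_Mapping.lookup m 1 = 0"
        from k[OF m] show False
        proof
          assume "Poly_Mapping.lookup m 3 = 0"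
          with deg[OF m] m1 key[OF m] \<open>even d\<close> show False by (simp add: x1 c1)
        next
          assume m3: "Poly_Mapping.lookup m 3 = d - 1"
          with deg[OF m] m1 d have "Poly_Mapping.lookup m 2 = 1" by simp
          with m3 key[OF m] y show False by (simp add: x1 c1)
        qed
      qed
      show "m = expo3 1 (d - 1) 0 \<or> m = expo3 1 0 (d - 1)" if "Poly_Mapping.lookup m 1 = 1"
        using k[OF m] deg[OF m] that d by (auto intro!: poly_mapping3_eqI simp del: One_nat_def)
    qed
    with ns show False by simp
  qed
  let ?k = "Poly_Mapping.lookup m 3" and ?j = "Poly_Mapping.lookup m 2"
  have xy: "x ^ ?j * y ^ ?k = 1" using key[OF m] \<open>c = 1\<close> by simp
  have xl: "x ^ (l * n) = 1" for n using x by (simp add: power_mult)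
  have yd: "y ^ ((d - 1) * n) = 1" for n using y \<open>c = 1\<close> by (simp add: power_mult)
  \<comment> \<open>The \<open>l\<close>-th power eliminates \<open>x\<close> and yields the
    divisibility of \<open>?k\<close>; then \<open>y ^ ?k = 1\<close>, which leaves a condition on
    \<open>x\<close> alone.\<close>
  have "(x ^ ?j * y ^ ?k) ^ l = x ^ (l * ?j) * y ^ (l * ?k)"
    by (simp add: power_mult_distrib mult.commute flip: power_mult)
  then have "y ^ (l * ?k) = 1" using xy xl by simp
  then have "l * (d - 1) dvd l * ?k" using xl by (intro ord)
  then have dk: "d - 1 dvd ?k" using l by simp
  then have "y ^ ?k = 1" using yd by (elim dvdE) simp
  then have "x ^ ?j = 1" using xy by simp
  then have "x ^ ((d - 1) * ?j) = 1" by (metis mult.commute power_mult power_one)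
  then have "l * (d - 1) dvd (d - 1) * ?j" using yd by (intro ord)
  then have lj: "l dvd ?j" using d by (simp add: mult.commute[of l])
  obtain e where e: "?k = (d - 1) * e" using dk by blast
  have "e < 2"
  proof (rule ccontr)
    assume "\<not> e < 2"
    then have "?k \<ge> (d - 1) * 2" unfolding e by (intro mult_le_mono2) simp
    then show False using deg[OF m] d by simp
  qed
  then consider "?k = 0" | "?k = d - 1" using e by (cases e) auto
  then show ?thesis
  proof cases
    case 1
    then have "m = expo3 (d - ?j) ?j 0"
      using deg[OF m] by (intro poly_mapping3_eqI) auto
    moreover have "?j \<le> d" using deg[OF m] by simp
    ultimately show ?thesis using lj by blast
  next
    case 2
    then have "?j \<le> 1" using deg[OF m] d by simp
    then have "?j = 0" using lj l(1) by (metis dvd_imp_le le_trans less_one neq0_conv not_less numeral_le_one_iff semiring_norm(69))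
    then have "m = expo3 1 0 (d - 1)"
      using 2 deg[OF m] d by (intro poly_mapping3_eqI) auto
    then show ?thesis by blast
  qed
qed

text \<open>Nonsingularity supplies, for each variable, a monomial of exponent at least
  \<open>d - 1\<close> in it. Since \<open>l\<close> divides neither \<open>1\<close> nor
  \<open>d - 1\<close>, these are \<open>X^d\<close>, \<open>Y^d\<close> and
  \<open>X Z^(d-1)\<close>; scaling the first two variables makes the first two coefficients
  \<open>1\<close>.\<close>

lemma exists_normal_form:
  fixes F :: "'a::{alg_closed_field, field_char_0} poly3"
  assumes d: "d \<ge> 5" and l: "l \<ge> 2" "l dvd d"
    and hom: "homogeneous d F" and ns: "nonsingular F"
    and A: "invertible A" "carries A F F"
    and ord: "\<And>n. (\<exists>t. \<forall>v. ((*v) A ^^ n) v = t *s v) \<longleftrightarrow> l * (d - 1) dvd n"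
  obtains P :: "'a ^ 3 ^ 3" and \<alpha> \<beta> where "invertible P" "\<alpha> \<noteq> 0"
    "\<And>v. eval F (P *v v) = normal_form d {j. 2 \<le> j \<and> j \<le> d - 2 \<and> l dvd j} \<alpha> \<beta> v"
proof -
  let ?J = "{j. 2 \<le> j \<and> j \<le> d - 2 \<and> l dvd j}"
  obtain P0 :: "'a ^ 3 ^ 3" and x y c where P0: "invertible P0"
    and inv: "\<And>v. eval F (P0 *v (vector [v $ 1, x * v $ 2, y * v $ 3])) = c * eval F (P0 *v v)"
    and xy: "x ^ l = 1" "y ^ (d - 1) = c" "c = 1 \<or> (x = -1 \<and> c = -1)"
    and xy_ord: "\<And>n. x ^ n = 1 \<Longrightarrow> y ^ n = 1 \<Longrightarrow> l * (d - 1) dvd n"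
    using semi_invariant_normal_coordinates[OF d l hom ns A ord] by blast
  define G where "G = lin_subst P0 F"
  have G: "homogeneous d G" "nonsingular G"
    unfolding G_def using nonsingular_lin_subst[OF P0 ns] homogeneous_lin_subst[OF hom] by auto
  have G_inv: "eval G (vector [v $ 1, x * v $ 2, y * v $ 3]) = c * eval G v" for v
    by (simp add: G_def eval_lin_subst inv)
  have keys: "m = expo3 1 0 (d - 1) \<or> (\<exists>j. l dvd j \<and> j \<le> d \<and> m = expo3 (d - j) j 0)"
    if "m \<in> Poly_Mapping.keys G" for m
    by (rule homogeneous_normal_monomials[OF d l G G_inv xy _ that]) (rule xy_ord)
  have l1: "\<not> l dvd 1" using l(1) by simp
  have ld: "\<not> l dvd d - 1"
  proof
    assume "l dvd d - 1"
    then have "l dvd d - (d - 1)" using l(2) by (rule dvd_diff_nat[rotated])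
    then show False using l1 d by simp
  qed
  have large: "\<exists>m\<in>Poly_Mapping.keys G. Poly_Mapping.lookup m i \<ge> d - 1" for i
  proof -
    obtain j where "Poly_Mapping.single i (d - 1) + Poly_Mapping.single j 1 \<in> Poly_Mapping.keys G"
      using nonsingular_imp_monomial[OF G(2,1)] d by auto
    then show ?thesis by (rule bexI[rotated]) (simp add: lookup_add)
  qed
  have "expo3 d 0 0 \<in> Poly_Mapping.keys G"
  proof -
    obtain m where m: "m \<in> Poly_Mapping.keys G" "Poly_Mapping.lookup m 1 \<ge> d - 1" using large by blast
    from keys[OF m(1)] m(2) d have "\<exists>j. l dvd j \<and> j \<le> 1 \<and> m = expo3 (d - j) j 0" by fastforce
    then have "m = expo3 d 0 0" using l1 by (metis One_nat_def diff_zero le_Suc_eq le_zero_eq)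
    with m show ?thesis by simp
  qed
  moreover have "expo3 0 d 0 \<in> Poly_Mapping.keys G"
  proof -
    obtain m where m: "m \<in> Poly_Mapping.keys G" "Poly_Mapping.lookup m 2 \<ge> d - 1" using large by blast
    from keys[OF m(1)] m(2) d obtain j where j: "l dvd j" "j \<le> d" "j \<ge> d - 1" "m = expo3 (d - j) j 0"
      by fastforce
    then have "j = d" using ld by (cases "j = d - 1") auto
    with j m show ?thesis by simp
  qed
  moreover have "expo3 1 0 (d - 1) \<in> Poly_Mapping.keys G"
  proof -
    obtain m where m: "m \<in> Poly_Mapping.keys G" "Poly_Mapping.lookup m 3 \<ge> d - 1" using large by blast
    from keys[OF m(1)] m(2) d have "m = expo3 1 0 (d - 1)" by fastforce
    with m show ?thesis by simp
  qed
  moreover define u where "u = (\<lambda>j. Poly_Mapping.lookup G (expo3 (d - j) j 0))"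
  moreover define g where "g = Poly_Mapping.lookup G (expo3 1 0 (d - 1))"
  ultimately have nz: "u 0 \<noteq> 0" "u d \<noteq> 0" "g \<noteq> 0" by (simp_all add: in_keys_iff)
  have eval_G: "eval G v = g * v $ 1 * v $ 3 ^ (d - 1) + u 0 * v $ 1 ^ d + u d * v $ 2 ^ d +
      (\<Sum>j\<in>?J. u j * v $ 1 ^ (d - j) * v $ 2 ^ j)" for v
  proof -
    let ?L = "{j. l dvd j \<and> j \<le> d}" and ?e = "\<lambda>j. expo3 (d - j) j 0"
    let ?S = "insert (expo3 1 0 (d - 1)) (?e ` ?L)"
    \<comment> \<open>The multiples \<open>1\<close> and \<open>d - 1\<close> are impossible, so
      apart from the ends \<open>0\<close> and \<open>d\<close> all lie between \<open>2\<close> and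
      \<open>d - 2\<close>.\<close>
    have L: "?L = insert 0 (insert d ?J)"
    proof (intro equalityI subsetI)
      fix j assume "j \<in> ?L"
      moreover from this have "j \<noteq> 1" "j \<noteq> d - 1" using l1 ld by auto
      ultimately show "j \<in> insert 0 (insert d ?J)" by auto
    qed (use l in auto)
    have finJ: "finite ?J" by (rule finite_subset[of _ "{..d}"]) auto
    then have finL: "finite ?L" unfolding L by simp
    have inj: "inj_on ?e ?L" by (rule inj_onI) (metis lookup_expo3(2))
    have notin: "expo3 1 0 (d - 1) \<notin> ?e ` ?L"
    proof
      assume "expo3 1 0 (d - 1) \<in> ?e ` ?L"
      then obtain j where "expo3 1 0 (d - 1) = ?e j" by blast
      then have "d - 1 = 0" by (metis lookup_expo3(3))
      then show False using d by simp
    qed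
    have "Poly_Mapping.keys G \<subseteq> ?S" using keys by blast
    moreover have "finite ?S" using finL by simp
    ultimately have "eval G v = (\<Sum>m\<in>?S. Poly_Mapping.lookup G m * mon_eval m v)"
      by (intro eval_superset)
    also have "\<dots> = g * v $ 1 * v $ 3 ^ (d - 1) + (\<Sum>j\<in>?L. u j * (v $ 1 ^ (d - j) * v $ 2 ^ j))"
      using notin finL by (simp add: sum.reindex[OF inj] g_def u_def mult.assoc)
    also have "(\<Sum>j\<in>?L. u j * (v $ 1 ^ (d - j) * v $ 2 ^ j)) = u 0 * v $ 1 ^ d + u d * v $ 2 ^ d +
        (\<Sum>j\<in>?J. u j * v $ 1 ^ (d - j) * v $ 2 ^ j)"
    proof -
      have "d \<notin> ?J" "0 \<notin> insert d ?J" using d by auto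
      then show ?thesis
        unfolding L using finJ by (subst sum.insert, simp, simp, subst sum.insert) (simp_all add: ac_simps)
    qed
    finally show ?thesis by (simp add: add.assoc)
  qed
  \<comment> \<open>The third variable stays unscaled, so the coefficient of
    \<open>X Z^(d-1)\<close> becomes \<open>g * s1\<close>.\<close>
  obtain s1 where s1: "s1 ^ d = inverse (u 0)" using nth_root_exists[of d "inverse (u 0)"] d by auto
  obtain s2 where s2: "s2 ^ d = inverse (u d)" using nth_root_exists[of d "inverse (u d)"] d by auto
  have s0: "s1 \<noteq> 0" "s2 \<noteq> 0" using s1 s2 nz d by (auto simp: power_0_left)
  define D where "D = ((\<chi> i k. if i = k then vector [s1, s2, 1] $ i else 0) :: 'a ^ 3 ^ 3)"
  have D: "(D *v v) $ i = vector [s1, s2, 1] $ i * v $ i" for v i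
    by (simp add: D_def matrix_vector_mult_def if_distrib[of "\<lambda>x. x * _"] cong: if_cong)
  have D3: "(D *v v) $ 1 = s1 * v $ 1" "(D *v v) $ 2 = s2 * v $ 2" "(D *v v) $ 3 = v $ 3" for v
    by (simp_all add: D)
  have "v = 0" if "D *v v = 0" for v
    using that s0 D3[of v] by (simp add: vec_eq_iff forall_3)
  then have "invertible D"
    unfolding invertible_left_inverse matrix_left_invertible_ker by blast
  with P0 have "invertible (P0 ** D)" by (rule invertible_mult)
  moreover have "eval F ((P0 ** D) *v v) =
      normal_form d ?J (g * s1) (\<lambda>j. u j * s1 ^ (d - j) * s2 ^ j) v" for v
  proof -
    have "eval F ((P0 ** D) *v v) = eval G (D *v v)"
      by (simp add: G_def eval_lin_subst flip: matrix_vector_mul_assoc)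
    also have "\<dots> = g * (s1 * v $ 1) * v $ 3 ^ (d - 1) + u 0 * (s1 ^ d * v $ 1 ^ d) +
        u d * (s2 ^ d * v $ 2 ^ d) + (\<Sum>j\<in>?J. u j * (s1 * v $ 1) ^ (d - j) * (s2 * v $ 2) ^ j)"
      by (simp add: eval_G D3 power_mult_distrib)
    also have "\<dots> = normal_form d ?J (g * s1) (\<lambda>j. u j * s1 ^ (d - j) * s2 ^ j) v"
    proof -
      have cancel: "u 0 * (inverse (u 0) * z) = z" "u d * (inverse (u d) * z) = z" for z
        using nz by (simp_all flip: mult.assoc)
      show ?thesis
        by (simp add: cancel normal_form_def binary_form_def s1 s2 power_mult_distrib ac_simps)
    qed
    finally show ?thesis .
  qed
  moreover have "g * s1 \<noteq> 0" using nz s0 by simp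
  ultimately show ?thesis using that by blast
qed

section \<open>The automorphism group\<close>

context group
begin

lemma ord_mult_coprime:
  assumes x: "x \<in> carrier G" and y: "y \<in> carrier G" and comm: "x \<otimes> y = y \<otimes> x"
    and cop: "coprime (ord x) (ord y)"
  shows "ord (x \<otimes> y) = ord x * ord y"
proof (rule dvd_antisym)
  show "ord (x \<otimes> y) dvd ord x * ord y"
    by (rule ord_mul_divides[OF comm x y])
  let ?t = "ord (x \<otimes> y)"
  have xy: "x \<otimes> y \<in> carrier G" using x y by simp
  have pow: "x [^] n \<otimes> y [^] n = \<one>" if "?t dvd n" for n
    using that xy pow_eq_id[OF xy, of n] pow_mult_distrib[OF comm x y, of n] by simp
  have "x [^] (?t * ord y) \<otimes> y [^] (?t * ord y) = \<one>" by (rule pow) simp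
  moreover have "y [^] (?t * ord y) = \<one>" using y by (simp add: pow_eq_id)
  ultimately have "ord x dvd ?t * ord y" using x by (simp add: pow_eq_id)
  then have 1: "ord x dvd ?t" using cop by (simp add: coprime_dvd_mult_left_iff)
  have "x [^] (?t * ord x) \<otimes> y [^] (?t * ord x) = \<one>" by (rule pow) simp
  moreover have "x [^] (?t * ord x) = \<one>" using x by (simp add: pow_eq_id)
  ultimately have "ord y dvd ?t * ord x" using y by (simp add: pow_eq_id)
  then have 2: "ord y dvd ?t" using cop by (simp add: coprime_dvd_mult_left_iff coprime_commute)
  show "ord x * ord y dvd ?t" using 1 2 cop by (rule semiring_gcd_class.divides_mult)
qed

text \<open>An element \<open>x\<close> of maximal order works: if a prime \<open>p\<close> occurred
  to a higher power in \<open>ord y\<close>, the part of \<open>x\<close> of order prime to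
  \<open>p\<close> times the \<open>p\<close>-part of \<open>y\<close> would have larger
  order.\<close>

lemma exists_ord_multiple:
  assumes fin: "finite (carrier G)" and comm: "\<And>x y. x \<in> carrier G \<Longrightarrow> y \<in> carrier G \<Longrightarrow> x \<otimes> y = y \<otimes> x"
  shows "\<exists>x\<in>carrier G. \<forall>y\<in>carrier G. ord y dvd ord x"
proof -
  have pos: "ord x > 0" if "x \<in> carrier G" for x using ord_ge_1[OF fin that] by simp
  obtain x where x: "x \<in> carrier G" and max: "\<And>y. y \<in> carrier G \<Longrightarrow> ord y \<le> ord x"
  proof -
    have "Max (ord ` carrier G) \<in> ord ` carrier G" using fin one_closed by (intro Max_in) auto
    then obtain x where x: "x \<in> carrier G" "Max (ord ` carrier G) = ord x" by blast
    have "ord y \<le> ord x" if "y \<in> carrier G" for y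
      unfolding x(2)[symmetric] using fin that by simp
    with x(1) that show thesis by blast
  qed
  have "ord y dvd ord x" if y: "y \<in> carrier G" for y
  proof (rule ccontr)
    assume "\<not> ord y dvd ord x"
    then obtain p where p: "prime p" "multiplicity p (ord x) < multiplicity p (ord y)"
      using pos[OF x] pos[OF y] multiplicity_le_imp_dvd[of "ord y" "ord x"]
      by (metis leI neq0_conv)
    define k where "k = multiplicity p (ord x)"
    have p1: "p > 1" using p(1) prime_gt_1_nat by blast
    obtain m where m: "ord x = p ^ k * m" "\<not> p dvd m"
      using multiplicity_decompose'[of "ord x" p] pos[OF x] p(1) unfolding k_def by (metis mult.commute neq0_conv not_prime_unit)
    have "p ^ Suc k dvd ord y"
      using p(2) unfolding k_def by (intro multiplicity_dvd') auto
    then obtain q where q: "ord y = p ^ Suc k * q" by blast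
    have q0: "q \<noteq> 0" using q pos[OF y] by (metis mult_0_right less_irrefl)
    have ox: "ord (x [^] (p ^ k)) = m"
      using ord_pow[OF x, of "p ^ k"] p1 unfolding m(1) by simp
    have oy: "ord (y [^] q) = p ^ Suc k"
      using ord_pow[OF y, of q] q q0 by simp
    have "coprime m (p ^ Suc k)"
      using prime_imp_coprime[OF p(1) m(2)] by (simp add: coprime_commute)
    then have "ord (x [^] (p ^ k) \<otimes> y [^] q) = m * p ^ Suc k"
      using ox oy x y by (subst ord_mult_coprime) (auto intro!: comm)
    moreover have "m * p ^ Suc k > ord x"
      using m(1) p1 pos[OF x] by simp
    moreover have "x [^] (p ^ k) \<otimes> y [^] q \<in> carrier G" using x y by simp
    ultimately show False using max by (metis leD)
  qed
  with x show ?thesis by blast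
qed

text \<open>If all orders divide \<open>ord x\<close>, the image of \<open>h\<close> consists of
  roots of \<open>z^(ord x) - 1\<close>, so there are at most \<open>ord x\<close> elements and the
  powers of \<open>x\<close> exhaust the group. The exponent \<open>N\<close> provides finiteness
  beforehand.\<close>

lemma cyclic_group_if_embeds_in_field:
  fixes h :: "'a \<Rightarrow> 'c::field_char_0"
  assumes hom: "\<And>x y. x \<in> carrier G \<Longrightarrow> y \<in> carrier G \<Longrightarrow> h (x \<otimes> y) = h x * h y"
    and inj: "inj_on h (carrier G)"
    and N: "N > 0" "\<And>x. x \<in> carrier G \<Longrightarrow> h x ^ N = 1"
  shows "cyclic_group G"
proof -
  have card: "finite S \<and> card S \<le> k" if "k > 0" "S \<subseteq> carrier G" "\<And>x. x \<in> S \<Longrightarrow> h x ^ k = 1" for k S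
  proof -
    have "h ` S \<subseteq> {z. z ^ k = 1}" using that by auto
    moreover have "inj_on h S" using inj that(2) by (rule inj_on_subset)
    ultimately show ?thesis
      using finite_power_eq[of k "1::'c"] that(1)
      by (metis (no_types, lifting) card_image card_mono finite_imageD finite_subset le_trans)
  qed
  have fin: "finite (carrier G)" using card[of N "carrier G"] N by blast
  have comm: "x \<otimes> y = y \<otimes> x" if "x \<in> carrier G" "y \<in> carrier G" for x y
    using that by (intro inj_onD[OF inj]) (simp_all add: hom mult.commute)
  obtain x where x: "x \<in> carrier G" and dvd: "\<And>y. y \<in> carrier G \<Longrightarrow> ord y dvd ord x"
    using exists_ord_multiple[OF fin comm] by blast
  have h1: "h \<one> = 1"
  proof -
    have "h \<one> * h \<one> = h \<one>" using hom[of \<one> \<one>] by simp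
    moreover have "h \<one> \<noteq> 0" using N by (metis one_closed power_0_left neq0_conv zero_neq_one)
    ultimately show ?thesis by simp
  qed
  have hp: "h (y [^] n) = h y ^ n" if "y \<in> carrier G" for y and n :: nat
    using that by (induction n) (auto simp: h1 hom mult.commute)
  have pos: "ord x > 0" using ord_ge_1[OF fin x] by simp
  have "h y ^ ord x = 1" if "y \<in> carrier G" for y
    using that dvd[OF that] hp[OF that, of "ord x"] h1 pow_eq_id[OF that, of "ord x"] by simp
  then have le: "card (carrier G) \<le> ord x" using card[of "ord x" "carrier G"] pos by blast
  let ?C = "(\<lambda>n. x [^] n) ` {0..ord x - 1}"
  have "card ?C = ord x"
    using card_image[OF ord_inj[OF x]] pos by simp
  moreover have "?C \<subseteq> carrier G" using x by auto
  ultimately have "?C = carrier G" using card_seteq[OF fin] le by metis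
  moreover have "x [^] n \<in> range (\<lambda>n::int. x [^] n)" for n :: nat
    by (rule range_eqI[of _ _ "int n"]) (simp add: int_pow_int)
  ultimately have "carrier G \<subseteq> range (\<lambda>n::int. x [^] n)" by (metis (mono_tags, lifting) image_subsetI)
  moreover have "range (\<lambda>n::int. x [^] n) \<subseteq> carrier G" using x by auto
  ultimately show ?thesis unfolding cyclic_group using x by blast
qed

end

section \<open>The projective linear group and the automorphism group inside it\<close>

lemma group_GL3: "group (GL3 :: ('a::field ^ 3 ^ 3) monoid)"
proof (rule groupI)
  fix A B C :: "'a ^ 3 ^ 3"
  show "\<one>\<^bsub>GL3\<^esub> \<in> carrier (GL3 :: ('a ^ 3 ^ 3) monoid)"
    by (auto simp: GL3_def invertible_def)
  show "A \<otimes>\<^bsub>GL3\<^esub> B \<in> carrier GL3" if "A \<in> carrier GL3" "B \<in> carrier GL3"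
    using that by (simp add: GL3_def invertible_mult)
  show "A \<otimes>\<^bsub>GL3\<^esub> B \<otimes>\<^bsub>GL3\<^esub> C = A \<otimes>\<^bsub>GL3\<^esub> (B \<otimes>\<^bsub>GL3\<^esub> C)"
    by (simp add: GL3_def matrix_mul_assoc)
  show "\<one>\<^bsub>GL3\<^esub> \<otimes>\<^bsub>GL3\<^esub> A = A" by (simp add: GL3_def)
  show "\<exists>B\<in>carrier GL3. B \<otimes>\<^bsub>GL3\<^esub> A = \<one>\<^bsub>GL3\<^esub>" if "A \<in> carrier GL3"
    using that by (auto simp: GL3_def invertible_def)
qed

lemma mat_mult_vector: "mat c *v v = c *s v"
  by (simp add: matrix_vector_mult_def mat_def vec_eq_iff if_distrib[of "\<lambda>x. x * _"] cong: if_cong)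

lemma matrix_eqI_vec:
  fixes A B :: "'a::comm_semiring_1 ^ 'n ^ 'm"
  assumes "\<And>v. A *v v = B *v v"
  shows "A = B"
  using assms by (simp add: matrix_eq)

lemma mat_commute: "mat c ** A = A ** mat c" for A :: "'a::field ^ 'n ^ 'n"
  by (rule matrix_eqI_vec) (simp flip: matrix_vector_mul_assoc add: mat_mult_vector vector_scalar_commute)

lemma normal_scalars3: "normal (scalars3 :: ('a::field ^ 3 ^ 3) set) GL3"
proof -
  interpret GL3: group "GL3 :: ('a ^ 3 ^ 3) monoid" by (rule group_GL3)
  have mm: "mat a ** mat b = (mat (a * b) :: 'a ^ 3 ^ 3)" for a b :: 'a
    by (rule matrix_eqI_vec) (simp flip: matrix_vector_mul_assoc add: mat_mult_vector)
  have inv: "invertible (mat a :: 'a ^ 3 ^ 3)" if "a \<noteq> 0" for a :: 'a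
    unfolding invertible_def using that mm[of a "inverse a"] mm[of "inverse a" a] by auto
  have sub: "subgroup (scalars3 :: ('a ^ 3 ^ 3) set) GL3"
  proof (rule GL3.subgroupI)
    show "scalars3 \<subseteq> carrier (GL3 :: ('a ^ 3 ^ 3) monoid)"
      by (auto simp: scalars3_def GL3_def inv)
    show "scalars3 \<noteq> ({} :: ('a ^ 3 ^ 3) set)"
      by (auto simp: scalars3_def intro: exI[of _ 1])
    fix A B :: "'a ^ 3 ^ 3"
    assume A: "A \<in> scalars3"
    then obtain a where a: "A = mat a" "a \<noteq> 0" by (auto simp: scalars3_def)
    have "inv\<^bsub>GL3\<^esub> A = mat (inverse a)"
      by (rule GL3.inv_equality) (use a inv in \<open>auto simp: GL3_def mm\<close>)
    then show "inv\<^bsub>GL3\<^esub> A \<in> scalars3" using a by (auto simp: scalars3_def)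
    assume "B \<in> scalars3"
    then obtain b where "B = mat b" "b \<noteq> 0" by (auto simp: scalars3_def)
    with a show "A \<otimes>\<^bsub>GL3\<^esub> B \<in> scalars3" by (auto simp: scalars3_def GL3_def mm)
  qed
  show ?thesis
    unfolding GL3.normal_inv_iff
  proof (intro conjI ballI sub)
    fix A h :: "'a ^ 3 ^ 3"
    assume A: "A \<in> carrier GL3" and h: "h \<in> scalars3"
    then obtain c where c: "h = mat c" by (auto simp: scalars3_def)
    have hG: "h \<in> carrier GL3" using subgroup.subset[OF sub] h by blast
    have "A \<otimes>\<^bsub>GL3\<^esub> h = h \<otimes>\<^bsub>GL3\<^esub> A" by (simp add: GL3_def c mat_commute)
    then have "A \<otimes>\<^bsub>GL3\<^esub> h \<otimes>\<^bsub>GL3\<^esub> inv\<^bsub>GL3\<^esub> A = h"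
      using A hG by (simp add: GL3.m_assoc)
    then show "A \<otimes>\<^bsub>GL3\<^esub> h \<otimes>\<^bsub>GL3\<^esub> inv\<^bsub>GL3\<^esub> A \<in> scalars3" using h by simp
  qed
qed

lemma coset_scalars3:
  fixes A :: "'a::field ^ 3 ^ 3"
  shows "scalars3 #>\<^bsub>GL3\<^esub> A = {mat c ** A | c. c \<noteq> 0}"
  by (auto simp: r_coset_def scalars3_def GL3_def)

lemma GL3_pow_mult_vector: "(A [^]\<^bsub>GL3\<^esub> (n::nat)) *v v = ((*v) A ^^ n) v"
  for A :: "'a::field ^ 3 ^ 3"
proof (induction n arbitrary: v)
  case 0
  then show ?case by (simp add: GL3_def)
next
  case (Suc n)
  have "A [^]\<^bsub>GL3\<^esub> Suc n = A [^]\<^bsub>GL3\<^esub> n ** A" by (simp add: GL3_def)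
  then show ?case
    by (simp only: Suc.IH funpow_Suc_right o_apply flip: matrix_vector_mul_assoc)
qed

lemma carries_mult:
  fixes F :: "'a::field_char_0 poly3"
  assumes "carries A F F" "carries B F F"
  shows "carries (A ** B) F F"
proof -
  obtain a b where "a \<noteq> 0" "b \<noteq> 0" "\<And>v. eval F (A *v v) = a * eval F v" "\<And>v. eval F (B *v v) = b * eval F v"
    using assms unfolding carries_iff by blast
  then have "a * b \<noteq> 0 \<and> (\<forall>v. eval F ((A ** B) *v v) = (a * b) * eval F v)"
    by (simp flip: matrix_vector_mul_assoc)
  then show ?thesis unfolding carries_iff by blast
qed

lemma carries_inverse:
  fixes F :: "'a::field_char_0 poly3"
  assumes "carries A F F" "A ** B = mat 1"
  shows "carries B F F"
proof -
  obtain a where a: "a \<noteq> 0" "\<And>v. eval F (A *v v) = a * eval F v"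
    using assms(1) unfolding carries_iff by blast
  have "eval F (B *v v) = inverse a * eval F v" for v
  proof -
    have "A *v (B *v v) = v" by (simp add: matrix_vector_mul_assoc assms(2))
    then have "eval F v = a * eval F (B *v v)" using a(2) by metis
    then show ?thesis using a(1) by simp
  qed
  then show ?thesis unfolding carries_iff using a(1) by (metis inverse_nonzero_iff_nonzero)
qed

lemma carrier_Aut: "carrier (Aut F) = {scalars3 #>\<^bsub>GL3\<^esub> A | A. A \<in> carrier GL3 \<and> carries A F F}"
  by (simp add: Aut_def)

lemma subgroup_Aut:
  fixes F :: "'a::field_char_0 poly3"
  shows "subgroup (carrier (Aut F)) PGL3"
proof -
  interpret GL3: group "GL3 :: ('a ^ 3 ^ 3) monoid" by (rule group_GL3)
  interpret S: normal "scalars3 :: ('a ^ 3 ^ 3) set" GL3 by (rule normal_scalars3)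
  have "group (PGL3 :: ('a ^ 3 ^ 3) set monoid)"
    unfolding PGL3_def by (rule S.factorgroup_is_group)
  then interpret PGL3: group "PGL3 :: ('a ^ 3 ^ 3) set monoid" .
  have one: "carries (mat 1) F F"
    unfolding carries_iff by (rule exI[of _ 1]) simp
  show ?thesis
  proof (rule PGL3.subgroupI)
    show sub: "carrier (Aut F) \<subseteq> carrier PGL3"
      by (auto simp: carrier_Aut PGL3_def carrier_FactGroup)
    have "mat 1 \<in> carrier (GL3 :: ('a ^ 3 ^ 3) monoid)"
      using GL3.one_closed by (simp add: GL3_def)
    then show "carrier (Aut F) \<noteq> {}"
      using one unfolding carrier_Aut by blast
    fix C assume C: "C \<in> carrier (Aut F)"
    then obtain A where A: "C = scalars3 #>\<^bsub>GL3\<^esub> A" "A \<in> carrier GL3" "carries A F F"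
      by (auto simp: carrier_Aut)
    have "A ** inv\<^bsub>GL3\<^esub> A = mat 1"
      using GL3.r_inv[OF A(2)] by (simp add: GL3_def)
    then have "carries (inv\<^bsub>GL3\<^esub> A) F F" by (rule carries_inverse[OF A(3)])
    moreover have "inv\<^bsub>PGL3\<^esub> C = scalars3 #>\<^bsub>GL3\<^esub> inv\<^bsub>GL3\<^esub> A"
      using C sub A S.inv_FactGroup[of C] S.rcos_inv[OF A(2)] by (auto simp: PGL3_def)
    ultimately show "inv\<^bsub>PGL3\<^esub> C \<in> carrier (Aut F)"
      using A(2) by (auto simp: carrier_Aut)
    fix C' assume "C' \<in> carrier (Aut F)"
    then obtain B where B: "C' = scalars3 #>\<^bsub>GL3\<^esub> B" "B \<in> carrier GL3" "carries B F F"
      by (auto simp: carrier_Aut)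
    have "C \<otimes>\<^bsub>PGL3\<^esub> C' = scalars3 #>\<^bsub>GL3\<^esub> (A \<otimes>\<^bsub>GL3\<^esub> B)"
      using A B S.rcos_sum by (simp add: PGL3_def)
    moreover have "carries (A \<otimes>\<^bsub>GL3\<^esub> B) F F"
      using carries_mult[OF A(3) B(3)] by (simp add: GL3_def)
    ultimately show "C \<otimes>\<^bsub>PGL3\<^esub> C' \<in> carrier (Aut F)"
      using A(2) B(2) by (auto simp: carrier_Aut)
  qed
qed

lemma group_Aut: "group (Aut F)" for F :: "'a::field_char_0 poly3"
proof -
  have "group (PGL3 :: ('a ^ 3 ^ 3) set monoid)"
    unfolding PGL3_def by (rule normal.factorgroup_is_group[OF normal_scalars3])
  moreover have "Aut F = PGL3\<lparr>carrier := carrier (Aut F)\<rparr>" by (simp add: Aut_def)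
  ultimately show ?thesis using subgroup.subgroup_is_group[OF subgroup_Aut] by metis
qed

lemma Aut_mult:
  fixes F :: "'a::field_char_0 poly3"
  assumes "A \<in> carrier GL3" "B \<in> carrier GL3"
  shows "(scalars3 #>\<^bsub>GL3\<^esub> A) \<otimes>\<^bsub>Aut F\<^esub> (scalars3 #>\<^bsub>GL3\<^esub> B) = scalars3 #>\<^bsub>GL3\<^esub> (A ** B)"
  using normal.rcos_sum[OF normal_scalars3 assms] by (simp add: Aut_def PGL3_def GL3_def)

lemma Aut_pow:
  fixes F :: "'a::field_char_0 poly3"
  assumes "A \<in> carrier GL3"
  shows "(scalars3 #>\<^bsub>GL3\<^esub> A) [^]\<^bsub>Aut F\<^esub> (n::nat) = scalars3 #>\<^bsub>GL3\<^esub> (A [^]\<^bsub>GL3\<^esub> n)"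
proof -
  have "(scalars3 #>\<^bsub>GL3\<^esub> A) [^]\<^bsub>Aut F\<^esub> n = (scalars3 #>\<^bsub>GL3\<^esub> A) [^]\<^bsub>PGL3\<^esub> n"
    by (simp add: Aut_def nat_pow_def)
  then show ?thesis
    using normal.FactGroup_pow[OF normal_scalars3 assms] by (simp add: PGL3_def)
qed

text \<open>Translates the order of a class into iterates of a representing linear map, the form in
  which diagonalisation uses it.\<close>

lemma Aut_ord_dvd_iff:
  fixes F :: "'a::field_char_0 poly3"
  assumes A: "A \<in> carrier GL3" "carries A F F"
  shows "group.ord (Aut F) (scalars3 #>\<^bsub>GL3\<^esub> A) dvd n \<longleftrightarrow> (\<exists>t. \<forall>v. ((*v) A ^^ n) v = t *s v)"
proof -
  interpret GL3: group "GL3 :: ('a ^ 3 ^ 3) monoid" by (rule group_GL3)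
  interpret Aut: group "Aut F" by (rule group_Aut)
  interpret S: normal "scalars3 :: ('a ^ 3 ^ 3) set" GL3 by (rule normal_scalars3)
  let ?B = "A [^]\<^bsub>GL3\<^esub> n"
  have B: "?B \<in> carrier GL3" using A(1) by simp
  have "scalars3 #>\<^bsub>GL3\<^esub> A \<in> carrier (Aut F)" using A by (auto simp: carrier_Aut)
  then have "group.ord (Aut F) (scalars3 #>\<^bsub>GL3\<^esub> A) dvd n \<longleftrightarrow> scalars3 #>\<^bsub>GL3\<^esub> ?B = scalars3"
    using Aut.pow_eq_id[of "scalars3 #>\<^bsub>GL3\<^esub> A" n] Aut_pow[OF A(1), where F = F and n = n]
    by (simp add: Aut_def PGL3_def)
  also have "\<dots> \<longleftrightarrow> ?B \<in> scalars3"
    using B S.subgroup_axioms by (metis GL3.coset_join1 GL3.coset_join2 S.subset)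
  also have "\<dots> \<longleftrightarrow> (\<exists>t. ?B = mat t)"
  proof
    assume "\<exists>t. ?B = mat t"
    then obtain t where t: "?B = mat t" by blast
    have "t \<noteq> 0"
    proof
      assume "t = 0"
      then have "?B *v v = 0" for v by (simp add: t mat_mult_vector)
      then have "?B *v axis 1 1 = 0" by blast
      moreover have "axis 1 1 \<noteq> (0 :: 'a ^ 3)" by (simp only: axis_eq_0_iff) simp
      moreover have "invertible ?B" using B by (simp add: GL3_def)
      ultimately show False by (metis invertible_left_inverse matrix_left_invertible_ker)
    qed
    then show "?B \<in> scalars3" using t by (auto simp: scalars3_def)
  qed (auto simp: scalars3_def)
  also have "\<dots> \<longleftrightarrow> (\<exists>t. \<forall>v. ((*v) A ^^ n) v = t *s v)"
    by (simp add: matrix_eq mat_mult_vector GL3_pow_mult_vector)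
  finally show ?thesis .
qed

text \<open>The \<open>d\<close>-th power of \<open>e * p\<close> is \<open>p\<close>, because
  \<open>e ^ d = 1\<close> and \<open>p ^ d = p\<close>.\<close>

lemma diagonal_ratio_inj:
  fixes e p e' p' :: "'a::field_char_0"
  assumes "d > 1" "e ^ d = 1" "p ^ (d - 1) = 1" "e' ^ d = 1" "p' ^ (d - 1) = 1" "e * p = e' * p'"
  shows "e = e' \<and> p = p'"
proof -
  have pd: "q ^ d = q" if "q ^ (d - 1) = 1" for q :: 'a
    using that assms(1) by (cases d) auto
  have "(e * p) ^ d = (e' * p') ^ d" by (simp only: assms(6))
  then have "p = p'"
    by (simp add: power_mult_distrib assms(2,4) pd[OF assms(3)] pd[OF assms(5)])
  moreover have "p' \<noteq> 0" using assms(1,5) by (cases "d = 1") (auto simp: power_0_left)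
  ultimately show ?thesis using assms(6) by simp
qed

text \<open>In the coordinates given by \<open>P\<close> all automorphisms are diagonal. The product
  of the two entry ratios is multiplicative on diagonal matrices, unchanged by scalars, and
  injective on classes by \<open>diagonal_ratio_inj\<close>.\<close>

lemma cyclic_Aut:
  fixes F :: "'a::field_char_0 poly3"
  assumes d: "d \<ge> 5" and J: "J \<subseteq> {2..d - 2}" and "\<alpha> \<noteq> 0" and P: "invertible P"
    and F: "\<And>v. eval F (P *v v) = normal_form d J \<alpha> \<beta> v"
  shows "cyclic_group (Aut F)"
proof -
  interpret GL3: group "GL3 :: ('a ^ 3 ^ 3) monoid" by (rule group_GL3)
  interpret Aut: group "Aut F" by (rule group_Aut)
  obtain Q where Q: "P ** Q = mat 1" "Q ** P = mat 1" using P by (auto simp: invertible_def)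
  define conj where "conj A = Q ** A ** P" for A
  define ratio :: "'a ^ 3 ^ 3 \<Rightarrow> 'a" where
    "ratio B = (B $ 2 $ 2 / B $ 1 $ 1) * (B $ 3 $ 3 / B $ 1 $ 1)" for B
  \<comment> \<open>The representative is arbitrary: \<open>ratio\<close> has degree zero in the
    entries, so a scalar factor cancels.\<close>
  define h where "h C = ratio (conj (SOME A. A \<in> C))" for C
  have conj_mult: "conj (A ** B) = conj A ** conj B" for A B
  proof -
    have "conj A ** conj B = Q ** A ** (P ** Q) ** B ** P" by (simp add: conj_def matrix_mul_assoc)
    then show ?thesis by (simp add: Q conj_def matrix_mul_assoc)
  qed
  have unconj: "A = P ** conj A ** Q" for A
  proof -
    have "P ** conj A ** Q = (P ** Q) ** A ** (P ** Q)" by (simp add: conj_def matrix_mul_assoc)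
    then show ?thesis by (simp add: Q)
  qed
  have conj_scale: "conj (mat t ** A) = mat t ** conj A" for t A
    using mat_commute[of t Q] by (simp add: conj_def matrix_mul_assoc)
  have scale: "(mat t ** B) $ i $ k = t * B $ i $ k" for t and B :: "'a ^ 3 ^ 3" and i k
    by (simp add: matrix_matrix_mult_def mat_def if_distrib[of "\<lambda>x. x * _"] cong: if_cong)
  have h: "h (scalars3 #>\<^bsub>GL3\<^esub> A) = ratio (conj A)" for A
  proof -
    let ?A = "SOME B. B \<in> scalars3 #>\<^bsub>GL3\<^esub> A"
    have "mat 1 ** A \<in> scalars3 #>\<^bsub>GL3\<^esub> A" unfolding coset_scalars3 by (intro CollectI exI[of _ 1]) simp
    then have "?A \<in> scalars3 #>\<^bsub>GL3\<^esub> A" by (rule someI)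
    then obtain t where "?A = mat t ** A" "t \<noteq> 0" unfolding coset_scalars3 by blast
    then show ?thesis by (simp add: h_def conj_scale ratio_def scale)
  qed
  have diag: "\<forall>i k. i \<noteq> k \<longrightarrow> conj A $ i $ k = 0" "\<forall>i. conj A $ i $ i \<noteq> 0"
    "(conj A $ 2 $ 2 / conj A $ 1 $ 1) ^ d = 1" "(conj A $ 3 $ 3 / conj A $ 1 $ 1) ^ (d - 1) = 1"
    if A: "A \<in> carrier GL3" "carries A F F" for A
  proof -
    obtain c where c: "c \<noteq> 0" "\<And>v. eval F (A *v v) = c * eval F v"
      using A(2) unfolding carries_iff by blast
    have "invertible A" "invertible Q" using A(1) Q by (auto simp: GL3_def invertible_def)
    then have inv: "invertible (conj A)" using P unfolding conj_def by (intro invertible_mult)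
    have nf: "normal_form d J \<alpha> \<beta> (conj A *v v) = c * normal_form d J \<alpha> \<beta> v" for v
    proof -
      have "P *v (conj A *v v) = (P ** Q) *v (A *v (P *v v))"
        by (simp only: conj_def matrix_vector_mul_assoc matrix_mul_assoc)
      then show ?thesis by (simp add: Q c(2) flip: F)
    qed
    note D = normal_form_automorphism_diagonal[OF d J \<open>\<alpha> \<noteq> 0\<close> c(1) inv nf]
    show "\<forall>i k. i \<noteq> k \<longrightarrow> conj A $ i $ k = 0" "\<forall>i. conj A $ i $ i \<noteq> 0" by (fact D(1), fact D(2))
    then show "(conj A $ 2 $ 2 / conj A $ 1 $ 1) ^ d = 1"
      "(conj A $ 3 $ 3 / conj A $ 1 $ 1) ^ (d - 1) = 1"
      using D(3,4) by (simp_all add: power_divide)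
  qed
  have diag_mult: "(B ** C) $ i $ i = B $ i $ i * C $ i $ i"
    if "\<forall>i k. i \<noteq> k \<longrightarrow> B $ i $ k = 0" for B C :: "'a ^ 3 ^ 3" and i
  proof -
    have "(\<Sum>k\<in>UNIV. B $ i $ k * C $ k $ i) = (\<Sum>k\<in>UNIV. if k = i then B $ i $ i * C $ i $ i else 0)"
      using that by (intro sum.cong) auto
    then show ?thesis by (simp add: matrix_matrix_mult_def)
  qed
  show ?thesis
  proof (rule Aut.cyclic_group_if_embeds_in_field[where h = h and N = "d * (d - 1)"])
    show "h (C \<otimes>\<^bsub>Aut F\<^esub> C') = h C * h C'" if CC: "C \<in> carrier (Aut F)" "C' \<in> carrier (Aut F)" for C C'
    proof -
      obtain A B where A: "C = scalars3 #>\<^bsub>GL3\<^esub> A" "A \<in> carrier GL3" "carries A F F"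
        and B: "C' = scalars3 #>\<^bsub>GL3\<^esub> B" "B \<in> carrier GL3" "carries B F F"
        using CC unfolding carrier_Aut by blast
      show ?thesis
        unfolding A(1) B(1) Aut_mult[OF A(2) B(2)] h conj_mult ratio_def
        by (simp add: diag_mult[OF diag(1)[OF A(2,3)]] ac_simps)
    qed
    show "inj_on h (carrier (Aut F))"
    proof (rule inj_onI)
      fix C C' assume C: "C \<in> carrier (Aut F)" "C' \<in> carrier (Aut F)" and eq: "h C = h C'"
      obtain A B where A: "C = scalars3 #>\<^bsub>GL3\<^esub> A" "A \<in> carrier GL3" "carries A F F"
        and B: "C' = scalars3 #>\<^bsub>GL3\<^esub> B" "B \<in> carrier GL3" "carries B F F"
        using C unfolding carrier_Aut by blast
      note DA = diag[OF A(2,3)] and DB = diag[OF B(2,3)]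
      have "conj A $ 2 $ 2 / conj A $ 1 $ 1 = conj B $ 2 $ 2 / conj B $ 1 $ 1 \<and>
          conj A $ 3 $ 3 / conj A $ 1 $ 1 = conj B $ 3 $ 3 / conj B $ 1 $ 1"
        by (rule diagonal_ratio_inj[OF _ DA(3,4) DB(3,4)])
           (use d eq in \<open>simp_all add: A(1) B(1) h ratio_def\<close>)
      \<comment> \<open>As the ratios to the first diagonal entry agree, the quotient of the first
        entries is the common scalar.\<close>
      moreover define t where "t = conj A $ 1 $ 1 / conj B $ 1 $ 1"
      ultimately have "conj A $ i $ i = t * conj B $ i $ i" for i
        using DA(2) DB(2) exhaust_3[of i] unfolding t_def by (auto simp: field_simps)
      then have "conj A $ i $ k = t * conj B $ i $ k" for i k
        using DA(1) DB(1) by (cases "i = k") auto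
      then have "conj A = mat t ** conj B" by (simp add: vec_eq_iff scale)
      then have "conj A = conj (mat t ** B)" by (simp add: conj_scale)
      then have "A = mat t ** B" using unconj by metis
      moreover have "t \<noteq> 0" using DA(2) DB(2) by (simp add: t_def)
      ultimately have "A \<in> scalars3 #>\<^bsub>GL3\<^esub> B" unfolding coset_scalars3 by blast
      then show "C = C'"
        unfolding A(1) B(1) using B(2) normal_imp_subgroup[OF normal_scalars3]
        by (metis GL3.repr_independence)
    qed
    show "d * (d - 1) > 0" using d by simp
    show "h C ^ (d * (d - 1)) = 1" if C: "C \<in> carrier (Aut F)" for C
    proof -
      obtain A where A: "C = scalars3 #>\<^bsub>GL3\<^esub> A" "A \<in> carrier GL3" "carries A F F"
        using C unfolding carrier_Aut by blast
      note DA = diag[OF A(2,3)]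
      let ?e = "conj A $ 2 $ 2 / conj A $ 1 $ 1" and ?p = "conj A $ 3 $ 3 / conj A $ 1 $ 1"
      have "h C ^ (d * (d - 1)) = (?e ^ d) ^ (d - 1) * (?p ^ (d - 1)) ^ d"
        unfolding A(1) h ratio_def power_mult_distrib by (simp only: power_mult[symmetric] mult.commute)
      then show ?thesis by (simp only: DA(3,4) power_one mult_1_left)
    qed
  qed
qed

theorem proposition48:
  fixes F :: "'a::{alg_closed_field, field_char_0} poly3"
    and d l :: nat
  assumes "d \<ge> 5" and "l \<ge> 2" and "l dvd d"
    and "plane_curve d F" and "nonsingular F"
    and "\<exists>\<sigma> \<in> carrier (Aut F). group.ord (Aut F) \<sigma> = l * (d - 1)"
  shows "(\<exists>(\<alpha>::'a) (\<beta>::nat \<Rightarrow> 'a). \<alpha> \<noteq> 0 \<and>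
            isomorphic_curves F
              (X ^ d + Y ^ d + Const \<alpha> * X * Z ^ (d - 1)
                + (\<Sum>j \<in> {j. 2 \<le> j \<and> j \<le> d - 2 \<and> l dvd j}. Const (\<beta> j) * X ^ (d - j) * Y ^ j)))
         \<and> cyclic_group (Aut F)"
proof -
  let ?J = "{j. 2 \<le> j \<and> j \<le> d - 2 \<and> l dvd j}"
  obtain A where A: "A \<in> carrier GL3" "carries A F F"
    and ord: "group.ord (Aut F) (scalars3 #>\<^bsub>GL3\<^esub> A) = l * (d - 1)"
    using assms(6) unfolding carrier_Aut by blast
  have hom: "homogeneous d F" using assms(4) by (simp add: plane_curve_def)
  have inv: "invertible A" using A(1) by (simp add: GL3_def)
  have ord': "(\<exists>t. \<forall>v. ((*v) A ^^ n) v = t *s v) \<longleftrightarrow> l * (d - 1) dvd n" for n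
    using Aut_ord_dvd_iff[OF A] ord by simp
  obtain P :: "'a ^ 3 ^ 3" and \<alpha> \<beta> where P: "invertible P" "\<alpha> \<noteq> 0"
    and F: "\<And>v. eval F (P *v v) = normal_form d ?J \<alpha> \<beta> v"
    using exists_normal_form[OF assms(1-3) hom assms(5) inv A(2) ord'] by blast
  let ?G = "X ^ d + Y ^ d + Const \<alpha> * X * Z ^ (d - 1)
      + (\<Sum>j\<in>?J. Const (\<beta> j) * X ^ (d - j) * Y ^ j)"
  obtain Q where Q: "P ** Q = mat 1" "Q ** P = mat 1" using P by (auto simp: invertible_def)
  have G: "eval ?G v = normal_form d ?J \<alpha> \<beta> v" for v
    by (simp add: eval_add eval_mult eval_power eval_sum normal_form_def binary_form_def)
  \<comment> \<open>\<open>carries\<close> substitutes into its last argument, so the map for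
    \<open>isomorphic_curves F ?G\<close> is the inverse \<open>Q\<close> of
    \<open>P\<close>.\<close>
  have "eval ?G (Q *v v) = 1 * eval F v" for v
  proof -
    have "eval ?G (Q *v v) = eval F (P *v (Q *v v))" by (simp only: G F)
    then show ?thesis by (simp add: matrix_vector_mul_assoc Q)
  qed
  then have "carries Q F ?G"
    unfolding carries_iff by (intro exI[of _ 1]) simp
  moreover have "invertible Q" using Q by (auto simp: invertible_def)
  ultimately have "isomorphic_curves F ?G" unfolding isomorphic_curves_def by blast
  moreover have "cyclic_group (Aut F)"
    by (rule cyclic_Aut[OF assms(1) _ P(2,1) F]) auto
  ultimately show ?thesis using P(2) by blast
qed

end
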